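(* Fix $n\ge1$. Partition the set of 3-periodic dissections of the convex $(n+2)$-gon into classes of dissections having the same quiddity. Every such class contains exactly one maximally open 3-periodic dissection.
   Context: Fix a convex $(n+2)$-gon with vertices labelled $0,1,\dots,n+1$ in counterclockwise cyclic order; its edges are $(i,i+1)$, $i\in\mathbb Z/(n+2)$, and its base edge is $(n+1,0)$. A dissection is a set of pairwise non-crossing diagonals (chords), partitioning the polygon into cells; the sides of a cell are the edges and chords bounding it. The quiddity of a dissection is $(a_0,\dots,a_{n+1})$ with $a_i$ the number of cells having vertex $i$. A dissection is 3-periodic if every cell has a number of vertices divisible by 3. The base cell is the cell containing the base edge. For a cell with vertices $0\le v_0<\dots<v_{r+1}\le n+1$, its sides are $(v_s,v_{s+1})$, $0\le s\le r+1$, with $v_{r+2}:=v_0$, and its base side is $(v_{r+1},v_0)$. The parent of a non-base cell is the other cell containing its base side; the level of a cell is its number of iterated parents. $\mathbb Z_3$-index: recursively on level, the base edge has index $0$, and if a cell's base side has index $c$ then its side $(v_s,v_{s+1})$ has index $c+s+1\bmod3$ for $0\le s\le r$. Sides $(v_s,v_{s+1}),(v_{s'},v_{s'+1})$, $s<s'$, of a cell are distant if $s'\ge s+3$ and $s\ge s'+3-(r+2)$. A 3-periodic opening surgery on a cell is the replacement of its base side and another side distant from it, both being chords of the same $\mathbb Z_3$-index, say $(v_s,v_{s+1})$ and $(v_{s'},v_{s'+1})$, by the chords $(v_{s+1},v_{s'})$ and $(v_{s'+1},v_s)$. A cell is maximally open if it admits no 3-periodic opening surgery; a 3-periodic dissection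 is maximally open if all its cells are. *)

theory Defs
  imports Main
begin

text \<open>Throughout, the polygon is the convex \<open>(n + 2)\<close>-gon with vertices \<open>0, \<dots>, n + 1\<close>;
  edges and chords are unordered pairs of vertices, represented as two-element sets.\<close>

definition polygon_edges :: "nat \<Rightarrow> nat set set" where
  "polygon_edges n = {{i, (i + 1) mod (n + 2)} | i. i < n + 2}"

definition base_edge :: "nat \<Rightarrow> nat set" where
  "base_edge n = {n + 1, 0}"

definition diagonals :: "nat \<Rightarrow> nat set set" where
  "diagonals n = {{i, j} | i j. i < n + 2 \<and> j < n + 2 \<and> i \<noteq> j} - polygon_edges n"

definition crossing :: "nat set \<Rightarrow> nat set \<Rightarrow> bool" where
  "crossing d e \<longleftrightarrow>
     (\<exists>i j k l. i < j \<and> j < k \<and> k < l \<and>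
        (d = {i, k} \<and> e = {j, l} \<or> d = {j, l} \<and> e = {i, k}))"

definition dissections :: "nat \<Rightarrow> nat set set set" where
  "dissections n = {D. D \<subseteq> diagonals n \<and> (\<forall>d\<in>D. \<forall>e\<in>D. \<not> crossing d e)}"

text \<open>A cell is represented by its set \<open>V\<close> of vertices; with \<open>v\<^sub>0 < \<dots> < v\<^sub>r\<^sub>+\<^sub>1\<close> the increasing
  enumeration of \<open>V\<close> we have \<open>r + 2 = card V\<close>, and \<open>vtx V s\<close> is \<open>v\<^sub>s\<close>, read cyclically
  so that \<open>v\<^sub>r\<^sub>+\<^sub>2 = v\<^sub>0\<close>.\<close>

definition vtx :: "nat set \<Rightarrow> nat \<Rightarrow> nat" where
  "vtx V s = sorted_list_of_set V ! (s mod card V)"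

definition side :: "nat set \<Rightarrow> nat \<Rightarrow> nat set" where
  "side V s = {vtx V s, vtx V (s + 1)}"

definition sides :: "nat set \<Rightarrow> nat set set" where
  "sides V = {side V s | s. s < card V}"

definition base_side :: "nat set \<Rightarrow> nat set" where
  "base_side V = side V (card V - 1)"

text \<open>The cells are the sub-polygons bounded by edges and chords of the dissection which no chord
  of the dissection cuts. As the chords do not cross, a chord meeting the interior of such a
  sub-polygon would have to join two of its vertices without being one of its sides.\<close>

definition cells :: "nat \<Rightarrow> nat set set \<Rightarrow> nat set set" where
  "cells n D = {V. V \<subseteq> {0..n + 1} \<and> card V \<ge> 3 \<and>
     sides V \<subseteq> polygon_edges n \<union> D \<and>
     (\<forall>d\<in>D. d \<subseteq> V \<longrightarrow> d \<in> sides V)}"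

definition quiddity :: "nat \<Rightarrow> nat set set \<Rightarrow> nat list" where
  "quiddity n D = map (\<lambda>i. card {V \<in> cells n D. i \<in> V}) [0..<n + 2]"

definition three_periodic_dissections :: "nat \<Rightarrow> nat set set set" where
  "three_periodic_dissections n = {D \<in> dissections n. \<forall>V\<in>cells n D. 3 dvd card V}"

text \<open>\<open>z3_index n D e c\<close> says that \<open>e\<close>, the base edge or a side of a cell, has index \<open>c\<close>.
  The base side of a non-base cell is a side, other than the base side, of exactly one further
  cell (its parent), so recursion on the level of cells is rule induction here.\<close>

inductive z3_index :: "nat \<Rightarrow> nat set set \<Rightarrow> nat set \<Rightarrow> nat \<Rightarrow> bool" for n D where
  base: "z3_index n D (base_edge n) 0"
| side: "\<lbrakk>V \<in> cells n D; z3_index n D (base_side V) c; s + 1 < card V\<rbrakk>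
         \<Longrightarrow> z3_index n D (side V s) ((c + s + 1) mod 3)"

definition distant :: "nat set \<Rightarrow> nat \<Rightarrow> nat \<Rightarrow> bool" where
  "distant V s s' \<longleftrightarrow>
     s < s' \<and> s' < card V \<and> s' \<ge> s + 3 \<and> int s \<ge> int s' + 3 - int (card V)"

text \<open>The base side of \<open>V\<close> is \<open>side V s'\<close> with \<open>s' = card V - 1\<close>, so any other side comes
  before it in the numbering.\<close>

definition opening_surgery ::
    "nat \<Rightarrow> nat set set \<Rightarrow> nat set \<Rightarrow> nat set set \<Rightarrow> bool" where
  "opening_surgery n D V D' \<longleftrightarrow>
     (\<exists>s s' c. s' = card V - 1 \<and> distant V s s' \<and>
        side V s \<in> D \<and> side V s' \<in> D \<and>
        z3_index n D (side V s) c \<and> z3_index n D (side V s') c \<and>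
        D' = (D - {side V s, side V s'}) \<union>
             {{vtx V (s + 1), vtx V s'}, {vtx V (s' + 1), vtx V s}})"

definition maximally_open_cell :: "nat \<Rightarrow> nat set set \<Rightarrow> nat set \<Rightarrow> bool" where
  "maximally_open_cell n D V \<longleftrightarrow> \<not> (\<exists>D'. opening_surgery n D V D')"

definition maximally_open :: "nat \<Rightarrow> nat set set \<Rightarrow> bool" where
  "maximally_open n D \<longleftrightarrow> (\<forall>V\<in>cells n D. maximally_open_cell n D V)"

definition same_quiddity :: "nat \<Rightarrow> (nat set set \<times> nat set set) set" where
  "same_quiddity n = {(D, D'). D \<in> three_periodic_dissections n \<and>
     D' \<in> three_periodic_dissections n \<and> quiddity n D = quiddity n D'}"

end

theory Submission
  imports Defs
begin

text \<open>The number of cells at a vertex exceeds the number of chords at it by one, so dissections have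
  the same quiddity iff their chords have the same degrees. In a cell of a 3-periodic dissection
  the sides with the index of the base side are those at positions \<open>s \<equiv> 2 (mod 3)\<close>, and all of
  them are distant from it.

  Existence: an opening surgery preserves degrees and 3-periodicity and decreases the sum of the
  lengths \<open>j - i\<close> of the chords \<open>{i, j}\<close>, so repeated surgery ends in a maximally open dissection.
  Uniqueness: read the chord ends vertex by vertex, each one either closing the innermost open chord
  or opening a new one. In a maximally open dissection an end that can close the innermost open
  chord (they have the same index) must do so, hence the degrees determine all choices.\<close>

section \<open>Consecutive elements and sides\<close>

definition consec :: "'a::linorder set \<Rightarrow> 'a \<Rightarrow> 'a \<Rightarrow> bool" where
  "consec V a b \<longleftrightarrow> a \<in> V \<and> b \<in> V \<and> a < b \<and> (\<forall>x\<in>V. x \<le> a \<or> b \<le> x)"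

lemma consec_right_unique:
  assumes "consec V a b" "consec V a c"
  shows "b = c"
  using assms unfolding consec_def by (metis leD order_antisym)

lemma consec_next_exists:
  assumes "finite V" "a \<in> V" "a < Max V"
  obtains b where "consec V a b"
proof
  let ?S = "{x \<in> V. a < x}"
  have "Max V \<in> V"
    using assms(1,2) Max_in by blast
  then have "finite ?S" "?S \<noteq> {}"
    using assms(1,3) by auto
  then have "Min ?S \<in> ?S" "\<forall>x\<in>?S. Min ?S \<le> x"
    using Min_in[of ?S] Min_le[of ?S] by blast+
  then show "consec V a (Min ?S)"
    using assms(2) by (auto simp: consec_def not_less[symmetric])
qed

lemma consec_around:
  assumes "finite V" "p \<in> V" "q \<in> V" "p < x" "x < q" "x \<notin> V"
  obtains a b where "consec V a b" "a < x" "x < b" "p \<le> a" "b \<le> q"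
proof -
  let ?A = "{y \<in> V. y < x}" and ?B = "{y \<in> V. x < y}"
  have nonempty: "?A \<noteq> {}" "?B \<noteq> {}"
    using assms by auto
  have "Max ?A \<in> ?A" "Min ?B \<in> ?B"
    using Max_in[OF _ nonempty(1)] Min_in[OF _ nonempty(2)] assms(1) by auto
  moreover have lower: "y \<le> Max ?A" if "y \<in> V" "y < x" for y
    using that assms(1) by simp
  moreover have upper: "Min ?B \<le> y" if "y \<in> V" "x < y" for y
    using that assms(1) by simp
  moreover have "y < x \<or> x < y" if "y \<in> V" for y
    using that assms(6) by (metis linorder_less_linear)
  ultimately have "consec V (Max ?A) (Min ?B)"
    unfolding consec_def by (blast intro: less_trans)
  then show ?thesis
    using that lower upper assms(2-5) \<open>Max ?A \<in> ?A\<close> \<open>Min ?B \<in> ?B\<close> by blast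
qed

lemma card_consec_split:
  assumes "finite V" "consec V a b"
  shows "card V = card {x \<in> V. x \<le> a} + card {x \<in> V. b \<le> x}"
proof -
  have "V = {x \<in> V. x \<le> a} \<union> {x \<in> V. b \<le> x}" "{x \<in> V. x \<le> a} \<inter> {x \<in> V. b \<le> x} = {}"
    using assms(2) by (auto simp: consec_def)
  then show ?thesis
    using assms(1) card_Un_disjoint[of "{x \<in> V. x \<le> a}" "{x \<in> V. b \<le> x}"] by simp
qed

lemma ex_other_than_two:
  assumes "card A \<ge> 3"
  shows "\<exists>x\<in>A. x \<noteq> u \<and> x \<noteq> v"
proof (rule ccontr)
  assume "\<not> ?thesis"
  then have "card A \<le> card {u, v}"
    by (intro card_mono) auto
  also have "\<dots> \<le> 2"
    using card_length[of "[u, v]"] by simp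
  finally show False
    using assms by simp
qed

lemma strict_mono_on_vtx:
  assumes "finite V"
  shows "strict_mono_on {..<card V} (vtx V)"
proof (rule strict_mono_onI)
  fix s t assume "s \<in> {..<card V}" "t \<in> {..<card V}" "s < t"
  then show "vtx V s < vtx V t"
    using assms strict_sorted_list_of_set[of V] by (simp add: vtx_def sorted_wrt_nth_less)
qed

lemma vtx_image:
  assumes "finite V"
  shows "vtx V ` {..<card V} = V"
proof -
  have "vtx V ` {..<card V} = (!) (sorted_list_of_set V) ` {..<length (sorted_list_of_set V)}"
    using assms by (intro image_cong) (auto simp: vtx_def)
  also have "\<dots> = V"
    using assms by (simp add: nth_image lessThan_atLeast0)
  finally show ?thesis .
qed

lemma vtx_in:
  assumes "finite V" "s < card V"
  shows "vtx V s \<in> V"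
  using assms vtx_image[of V] imageI[of s "{..<card V}" "vtx V"] by simp

lemma vtx_surj:
  assumes "finite V" "x \<in> V"
  obtains s where "s < card V" "x = vtx V s"
  using assms vtx_image[of V] by (metis imageE lessThan_iff)

lemma vtx_less_iff:
  assumes "finite V" "s < card V" "t < card V"
  shows "vtx V s < vtx V t \<longleftrightarrow> s < t"
  using strict_mono_on_less[OF strict_mono_on_vtx[OF assms(1)]] assms(2,3) by simp

lemma vtx_le_iff:
  assumes "finite V" "s < card V" "t < card V"
  shows "vtx V s \<le> vtx V t \<longleftrightarrow> s \<le> t"
  using vtx_less_iff[OF assms(1,3,2)] by (simp add: not_less[symmetric])

lemma card_le_vtx:
  assumes "finite V" "s < card V"
  shows "card {x \<in> V. x \<le> vtx V s} = s + 1"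
proof -
  have "{x \<in> V. x \<le> vtx V s} = {x \<in> vtx V ` {..<card V}. x \<le> vtx V s}"
    using assms by (simp add: vtx_image)
  also have "\<dots> = vtx V ` {..s}"
    using assms by (force simp: vtx_le_iff)
  finally have "{x \<in> V. x \<le> vtx V s} = vtx V ` {..s}" .
  moreover have "inj_on (vtx V) {..s}"
    by (rule inj_on_subset[OF strict_mono_on_imp_inj_on[OF strict_mono_on_vtx[OF assms(1)]]])
      (use assms(2) in auto)
  ultimately show ?thesis
    by (simp add: card_image)
qed

lemma vtx_first:
  assumes "finite V" "V \<noteq> {}"
  shows "vtx V 0 = Min V"
proof (rule Min_eqI[symmetric])
  fix y assume "y \<in> V"
  then obtain t where "t < card V" "y = vtx V t"
    using vtx_surj[OF assms(1)] by blast
  then show "vtx V 0 \<le> y"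
    using assms(1) by (simp add: vtx_le_iff)
qed (use assms in \<open>simp_all add: vtx_in card_gt_0_iff\<close>)

lemma vtx_last:
  assumes "finite V" "V \<noteq> {}"
  shows "vtx V (card V - 1) = Max V"
proof (rule Max_eqI[symmetric])
  fix y assume "y \<in> V"
  then obtain t where "t < card V" "y = vtx V t"
    using vtx_surj[OF assms(1)] by blast
  then show "y \<le> vtx V (card V - 1)"
    using assms(1) by (simp add: vtx_le_iff)
qed (use assms in \<open>simp_all add: vtx_in card_gt_0_iff\<close>)

lemma vtx_card: "vtx V (card V) = vtx V 0"
  by (simp add: vtx_def)

lemma consec_iff_vtx:
  assumes "finite V"
  shows "consec V a b \<longleftrightarrow> (\<exists>s. s + 1 < card V \<and> a = vtx V s \<and> b = vtx V (s + 1))"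
proof
  assume ab: "consec V a b"
  then obtain s t where st: "s < card V" "t < card V" "a = vtx V s" "b = vtx V t"
    using vtx_surj[OF assms] unfolding consec_def by metis
  then have "s < t"
    using ab assms by (simp add: consec_def vtx_less_iff)
  moreover from this have "vtx V (s + 1) \<in> V"
    using st assms by (simp add: vtx_in)
  then have "vtx V (s + 1) \<le> a \<or> b \<le> vtx V (s + 1)"
    using ab by (simp add: consec_def)
  ultimately have "t = s + 1"
    using st assms by (simp add: vtx_le_iff)
  then show "\<exists>s. s + 1 < card V \<and> a = vtx V s \<and> b = vtx V (s + 1)"
    using st by blast
next
  assume "\<exists>s. s + 1 < card V \<and> a = vtx V s \<and> b = vtx V (s + 1)"
  then obtain s where s: "s + 1 < card V" "a = vtx V s" "b = vtx V (s + 1)"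
    by blast
  have "x \<le> a \<or> b \<le> x" if "x \<in> V" for x
  proof -
    obtain t where "t < card V" "x = vtx V t"
      using vtx_surj[OF assms \<open>x \<in> V\<close>] .
    then show ?thesis
      using s assms by (auto simp: vtx_le_iff)
  qed
  then show "consec V a b"
    using s assms by (simp add: consec_def vtx_in vtx_less_iff)
qed

lemma base_side_eq:
  assumes "finite V" "V \<noteq> {}"
  shows "base_side V = {Min V, Max V}"
proof -
  have "card V - 1 + 1 = card V"
    using assms by (simp add: card_gt_0_iff)
  then show ?thesis
    using vtx_first[OF assms] vtx_last[OF assms]
    by (simp add: base_side_def side_def vtx_card insert_commute)
qed

lemma sides_eq:
  assumes "finite V" "V \<noteq> {}"
  shows "sides V = insert {Min V, Max V} {{a, b} | a b. consec V a b}"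
proof -
  have "{..<card V} = insert (card V - 1) {s. s + 1 < card V}"
    using card_gt_0_iff[of V] assms by auto
  moreover have "sides V = side V ` {..<card V}"
    by (auto simp: sides_def)
  ultimately have "sides V = insert (base_side V) (side V ` {s. s + 1 < card V})"
    by (simp add: base_side_def)
  also have "side V ` {s. s + 1 < card V} = {{a, b} | a b. consec V a b}"
    using assms(1) by (auto simp: consec_iff_vtx side_def)
  finally show ?thesis
    using base_side_eq[OF assms] by simp
qed

section \<open>Cells of a dissection\<close>

lemma polygon_edges_eq: "polygon_edges n = insert {0, n + 1} {{i, i + 1} | i. i \<le> n}"
proof -
  have "polygon_edges n = (\<lambda>i. {i, (i + 1) mod (n + 2)}) ` {..n + 1}"
    by (auto simp: polygon_edges_def less_Suc_eq_le)
  also have "{..n + 1} = insert (n + 1) {..n}"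
    by auto
  also have "(\<lambda>i. {i, (i + 1) mod (n + 2)}) ` \<dots> = insert {n + 1, 0} ((\<lambda>i. {i, i + 1}) ` {..n})"
    by simp
  also have "\<dots> = insert {0, n + 1} {{i, i + 1} | i. i \<le> n}"
    by (auto simp: insert_commute)
  finally show ?thesis .
qed

lemma crossing_doubleton_iff:
  assumes "a < b" "c < d"
  shows "crossing {a, b} {c, d} \<longleftrightarrow> a < c \<and> c < b \<and> b < d \<or> c < a \<and> a < d \<and> d < b"
proof
  assume "crossing {a, b} {c, d}"
  then show "a < c \<and> c < b \<and> b < d \<or> c < a \<and> a < d \<and> d < b"
    using assms unfolding crossing_def by (auto simp: doubleton_eq_iff)
next
  assume "a < c \<and> c < b \<and> b < d \<or> c < a \<and> a < d \<and> d < b"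
  then show "crossing {a, b} {c, d}"
    unfolding crossing_def by blast
qed

definition linked :: "nat \<Rightarrow> nat set set \<Rightarrow> nat \<Rightarrow> nat \<Rightarrow> bool" where
  "linked n D a b \<longleftrightarrow> a < b \<and> {a, b} \<in> polygon_edges n \<union> D"

definition covered :: "nat set set \<Rightarrow> nat \<Rightarrow> nat \<Rightarrow> nat \<Rightarrow> bool" where
  "covered D i j x \<longleftrightarrow> (\<exists>a b. i \<le> a \<and> a < x \<and> x < b \<and> b \<le> j \<and> (a, b) \<noteq> (i, j) \<and> {a, b} \<in> D)"

definition cell_below :: "nat set set \<Rightarrow> nat \<Rightarrow> nat \<Rightarrow> nat set" where
  "cell_below D i j = {x \<in> {i..j}. \<not> covered D i j x}"

lemma coveredE:
  assumes "covered D i j x"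
  obtains a b where "i \<le> a" "a < x" "x < b" "b \<le> j" "(a, b) \<noteq> (i, j)" "{a, b} \<in> D"
  using assms unfolding covered_def by blast

lemma cell_below_ends:
  assumes "i \<le> j"
  shows "i \<in> cell_below D i j" "j \<in> cell_below D i j"
    "Min (cell_below D i j) = i" "Max (cell_below D i j) = j"
proof -
  show ends: "i \<in> cell_below D i j" "j \<in> cell_below D i j"
    using assms by (auto simp: cell_below_def covered_def)
  show "Min (cell_below D i j) = i" "Max (cell_below D i j) = j"
    using ends by (auto simp: cell_below_def intro!: Min_eqI Max_eqI)
qed

locale dissection =
  fixes n :: nat and D :: "nat set set"
  assumes n_pos: "n \<ge> 1" and dissection: "D \<in> dissections n"
begin

abbreviation link :: "nat \<Rightarrow> nat \<Rightarrow> bool" where "link \<equiv> linked n D"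

lemma chord_doubletonE:
  assumes "d \<in> D"
  obtains a b where "d = {a, b}" "a < b"
proof -
  have "d \<in> diagonals n"
    using assms dissection by (auto simp: dissections_def)
  then obtain i j where "d = {i, j}" "i \<noteq> j"
    by (auto simp: diagonals_def)
  then show ?thesis
    using that[of i j] that[of j i] by (metis insert_commute linorder_neqE_nat)
qed

lemma chordD:
  assumes "{a, b} \<in> D" "a < b"
  shows "a + 1 < b" "b \<le> n + 1" "(a, b) \<noteq> (0, n + 1)" "link a b"
proof -
  have "{a, b} \<in> diagonals n"
    using assms(1) dissection by (auto simp: dissections_def)
  then have "{a, b} \<notin> polygon_edges n" and le: "b \<le> n + 1"
    using assms(2) by (auto simp: diagonals_def doubleton_eq_iff)
  then have "(a, b) \<noteq> (0, n + 1)" "b \<noteq> a + 1"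
    by (auto simp: polygon_edges_eq)
  then show "a + 1 < b" "b \<le> n + 1" "(a, b) \<noteq> (0, n + 1)" "link a b"
    using le assms by (auto simp: linked_def)
qed

lemma not_chord_loop: "{a, a} \<notin> D"
proof
  assume "{a, a} \<in> D"
  then obtain i j where "{a, a} = {i, j}" "i < j"
    by (rule chord_doubletonE)
  then show False
    by (auto simp: doubleton_eq_iff)
qed

lemma finite_chords: "finite D"
proof (rule finite_subset)
  show "D \<subseteq> Pow {0..n + 1}"
  proof
    fix d assume d: "d \<in> D"
    then obtain a b where "d = {a, b}" "a < b"
      by (rule chord_doubletonE)
    then show "d \<in> Pow {0..n + 1}"
      using chordD(2)[of a b] d by auto
  qed
qed simp

lemma link_iff: "link a b \<longleftrightarrow> a < b \<and> b \<le> n + 1 \<and> ({a, b} \<in> D \<or> b = a + 1 \<or> a = 0 \<and> b = n + 1)"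
proof -
  have "{a, b} \<in> polygon_edges n \<longleftrightarrow> b \<le> n + 1 \<and> (b = a + 1 \<or> a = 0 \<and> b = n + 1)" if "a < b"
    using that by (auto simp: polygon_edges_eq doubleton_eq_iff)
  then show ?thesis
    using chordD(2)[of a b] by (auto simp: linked_def)
qed

lemma link_not_crossing:
  assumes "link a b" "link c d" "a < c" "c < b"
  shows "d \<le> b"
proof (cases "{a, b} \<in> D \<and> {c, d} \<in> D")
  case True
  then have "\<not> crossing {a, b} {c, d}"
    using dissection by (auto simp: dissections_def)
  then show ?thesis
    using assms(1-4) by (auto simp: crossing_doubleton_iff linked_def)
qed (use assms in \<open>auto simp: link_iff\<close>)

lemma sides_subset_iff:
  assumes "finite V" "V \<noteq> {}" "Min V < Max V"
  shows "sides V \<subseteq> polygon_edges n \<union> D \<longleftrightarrow>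
    link (Min V) (Max V) \<and> (\<forall>a b. consec V a b \<longrightarrow> link a b)"
  using assms(3) by (auto simp: sides_eq[OF assms(1,2)] linked_def consec_def)

lemma chords_are_sides_iff:
  assumes "V \<subseteq> {0..n + 1}" "V \<noteq> {}" "Min V < Max V"
  shows "(\<forall>d\<in>D. d \<subseteq> V \<longrightarrow> d \<in> sides V) \<longleftrightarrow>
    (\<forall>a\<in>V. \<forall>b\<in>V. link a b \<longrightarrow> consec V a b \<or> a = Min V \<and> b = Max V)"
proof (intro iffI ballI impI)
  have V: "finite V" "\<And>x. x \<in> V \<Longrightarrow> x \<le> n + 1"
    using assms(1) finite_subset by auto
  note sides_V = sides_eq[OF V(1) assms(2)]
  fix a b assume sides: "\<forall>d\<in>D. d \<subseteq> V \<longrightarrow> d \<in> sides V" and ab: "a \<in> V" "b \<in> V" "link a b"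
  consider (chord) "{a, b} \<in> D" | (edge) "b = a + 1" | (base) "a = 0" "b = n + 1"
    using ab(3) link_iff by blast
  then show "consec V a b \<or> a = Min V \<and> b = Max V"
  proof cases
    case chord
    then have "{a, b} \<in> sides V"
      using sides ab by simp
    then show ?thesis
      using ab(3) assms(3) by (auto simp: sides_V doubleton_eq_iff linked_def consec_def)
  next
    case edge
    then show ?thesis
      using ab by (auto simp: consec_def)
  next
    case base
    then show ?thesis
      using ab V by (metis Max_eqI Min_eqI zero_le)
  qed
next
  fix d assume link_sides: "\<forall>a\<in>V. \<forall>b\<in>V. link a b \<longrightarrow> consec V a b \<or> a = Min V \<and> b = Max V"
    and d: "d \<in> D" "d \<subseteq> V"
  then obtain a b where "d = {a, b}" "a < b"
    using chord_doubletonE by blast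
  then have "consec V a b \<or> a = Min V \<and> b = Max V"
    using link_sides d by (simp add: linked_def)
  then show "d \<in> sides V"
    using sides_eq[of V] finite_subset[OF assms(1)] assms(2) \<open>d = {a, b}\<close> by auto
qed

lemma cells_iff:
  "V \<in> cells n D \<longleftrightarrow> V \<subseteq> {0..n + 1} \<and> card V \<ge> 3 \<and> link (Min V) (Max V) \<and>
     (\<forall>a b. consec V a b \<longrightarrow> link a b) \<and>
     (\<forall>a\<in>V. \<forall>b\<in>V. link a b \<longrightarrow> consec V a b \<or> a = Min V \<and> b = Max V)"
proof (cases "V \<subseteq> {0..n + 1} \<and> card V \<ge> 3")
  case True
  then have V: "finite V" "V \<noteq> {}"
    using finite_subset by auto
  then have "V \<subseteq> {Min V..Max V}"
    by auto
  then have "card V \<le> Max V + 1 - Min V"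
    using card_mono[of "{Min V..Max V}" V] by simp
  then have "Min V < Max V"
    using True by linarith
  then show ?thesis
    using True sides_subset_iff[OF V] chords_are_sides_iff[of V] V(2) by (simp add: cells_def)
qed (auto simp: cells_def)

lemma cellD:
  assumes "V \<in> cells n D"
  shows "finite V" "card V \<ge> 3" "V \<noteq> {}" "Min V \<in> V" "Max V \<in> V"
proof -
  show "finite V" "card V \<ge> 3"
    using assms finite_subset[of V "{0..n + 1}"] by (auto simp: cells_iff)
  then show "V \<noteq> {}"
    by auto
  then show "Min V \<in> V" "Max V \<in> V"
    using \<open>finite V\<close> by simp_all
qed

lemma cell_bounds:
  assumes "V \<in> cells n D" "x \<in> V"
  shows "Min V \<le> x" "x \<le> Max V"
  using cellD(1)[OF assms(1)] assms(2) by simp_all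

lemma cell_base_link: "V \<in> cells n D \<Longrightarrow> link (Min V) (Max V)"
  by (simp add: cells_iff)

lemma cell_consec_link: "V \<in> cells n D \<Longrightarrow> consec V a b \<Longrightarrow> link a b"
  by (simp add: cells_iff)

lemma cell_link_side:
  assumes "V \<in> cells n D" "a \<in> V" "b \<in> V" "link a b"
  shows "consec V a b \<or> a = Min V \<and> b = Max V"
  using assms by (simp add: cells_iff)

lemma cell_between:
  assumes "V \<in> cells n D"
  obtains v where "v \<in> V" "Min V < v" "v < Max V"
proof -
  obtain v where "v \<in> V" "v \<noteq> Min V" "v \<noteq> Max V"
    using ex_other_than_two cellD(2)[OF assms] by metis
  then show ?thesis
    using that cell_bounds[OF assms] by (metis order_less_le)
qed

lemma cell_consec_not_ends:
  assumes "V \<in> cells n D" "consec V a b"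
  shows "(a, b) \<noteq> (Min V, Max V)"
proof -
  obtain v where "v \<in> V" "Min V < v" "v < Max V"
    using cell_between[OF assms(1)] .
  then show ?thesis
    using assms(2) by (auto simp: consec_def)
qed

lemma cell_long_base:
  assumes "V \<in> cells n D"
  shows "Min V + 1 < Max V"
  using cell_between[OF assms] by (metis Suc_eq_plus1 Suc_lessI less_trans not_less_eq)

lemma cell_consec_not_base:
  assumes "V \<in> cells n D" "consec V a b"
  shows "(a, b) \<noteq> (0, n + 1)"
proof
  assume "(a, b) = (0, n + 1)"
  moreover have "a \<in> V" "b \<in> V" "Max V \<le> n + 1"
    using assms cell_base_link[OF assms(1)] by (auto simp: consec_def link_iff)
  ultimately have "(a, b) = (Min V, Max V)"
    using cell_bounds[OF assms(1)] by (metis Pair_inject le_antisym zero_le)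
  then show False
    using cell_consec_not_ends[OF assms] by contradiction
qed

lemma cell_consec_chord:
  assumes "V \<in> cells n D" "consec V a b" "b \<noteq> a + 1"
  shows "{a, b} \<in> D"
  using cell_consec_link[OF assms(1,2)] cell_consec_not_base[OF assms(1,2)] assms(3)
  by (auto simp: link_iff)

lemma link_left_end_in_cell:
  assumes "V \<in> cells n D" "link a b" "x \<in> V" "a < x" "x < b" "Min V \<le> a"
  shows "a \<in> V"
proof (rule ccontr)
  assume "a \<notin> V"
  moreover from this have "Min V < a"
    using assms(6) cellD(4)[OF assms(1)] by (metis order_less_le)
  ultimately obtain p q where "consec V p q" "p < a" "a < q" "q \<le> x"
    using consec_around[OF cellD(1,4)[OF assms(1)] assms(3)] assms(4) by metis
  then show False
    using link_not_crossing[OF cell_consec_link[OF assms(1)] assms(2)] assms(5) by fastforce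
qed

lemma link_right_end_in_cell:
  assumes "V \<in> cells n D" "link a b" "x \<in> V" "a < x" "x < b" "b \<le> Max V"
  shows "b \<in> V"
proof (rule ccontr)
  assume "b \<notin> V"
  moreover from this have "b < Max V"
    using assms(6) cellD(5)[OF assms(1)] by (metis order_less_le)
  ultimately obtain p q where "consec V p q" "p < b" "b < q" "x \<le> p"
    using consec_around[OF cellD(1)[OF assms(1)] assms(3) cellD(5)[OF assms(1)] assms(5)] by metis
  then show False
    using link_not_crossing[OF assms(2) cell_consec_link[OF assms(1)]] assms(4) by fastforce
qed

lemma link_over_cell:
  assumes "V \<in> cells n D" "link a b" "x \<in> V" "a < x" "x < b"
  shows "a \<le> Min V \<and> Max V \<le> b"
proof -
  have x: "Min V \<le> x" "x \<le> Max V"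
    using cell_bounds[OF assms(1,3)] by auto
  consider (left) "a < Min V" | (right) "Max V < b" | (inside) "Min V \<le> a" "b \<le> Max V"
    by linarith
  then show ?thesis
  proof cases
    case left
    then show ?thesis
      using link_not_crossing[OF assms(2) cell_base_link[OF assms(1)]] x assms(5) by simp
  next
    case right
    then show ?thesis
      using link_not_crossing[OF cell_base_link[OF assms(1)] assms(2)] x assms(4) by fastforce
  next
    case inside
    then have "a \<in> V" "b \<in> V"
      using link_left_end_in_cell link_right_end_in_cell assms by blast+
    moreover have "\<not> consec V a b"
      using assms(3-5) unfolding consec_def by (metis not_le)
    ultimately show ?thesis
      using cell_link_side[OF assms(1) _ _ assms(2)] by auto
  qed
qed

lemma link_not_over_cell_below:
  assumes "link i j" "link a b" "i \<le> a" "b \<le> j" "(a, b) \<noteq> (i, j)" "x \<in> cell_below D i j"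
  shows "x \<le> a \<or> b \<le> x"
proof (rule ccontr)
  assume "\<not> (x \<le> a \<or> b \<le> x)"
  then have x: "a < x" "x < b"
    by auto
  then have "{a, b} \<in> D"
    using assms(1-5) by (auto simp: link_iff)
  then have "covered D i j x"
    unfolding covered_def using assms(3-5) x by blast
  then show False
    using assms(6) by (simp add: cell_below_def)
qed

lemma furthest_link_in_cell_below:
  assumes "a \<in> cell_below D i j" and b: "link a b" "b \<le> j"
    and furthest: "\<And>q. link a q \<Longrightarrow> q \<le> j \<Longrightarrow> (a, q) \<noteq> (i, j) \<Longrightarrow> q \<le> b"
  shows "b \<in> cell_below D i j"
proof -
  have a: "i \<le> a" "\<not> covered D i j a"
    using assms(1) by (auto simp: cell_below_def)
  have "a < b"
    using b(1) by (simp add: linked_def)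
  have "\<not> covered D i j b"
  proof
    assume "covered D i j b"
    then obtain c d where cd: "i \<le> c" "c < b" "b < d" "d \<le> j" "(c, d) \<noteq> (i, j)" "{c, d} \<in> D"
      by (rule coveredE)
    then have "link c d"
      using chordD(4) by simp
    then have "\<not> a < c"
      using link_not_crossing[OF b(1)] cd(2,3) by fastforce
    moreover have "\<not> c < a"
      using a(2) \<open>a < b\<close> cd unfolding covered_def by (metis less_trans)
    moreover have "c \<noteq> a"
      using furthest[of d] \<open>link c d\<close> cd by auto
    ultimately show False
      by simp
  qed
  then show ?thesis
    using a(1) \<open>a < b\<close> b(2) by (simp add: cell_below_def)
qed

lemma cell_below_next:
  assumes "link i j" "i + 1 < j" "a \<in> cell_below D i j" "a < j"
  obtains b where "consec (cell_below D i j) a b" "link a b" "(a, b) \<noteq> (i, j)"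
proof
  let ?P = "\<lambda>q. link a q \<and> q \<le> j \<and> (a, q) \<noteq> (i, j)"
  define b where "b = (GREATEST q. ?P q)"
  have "?P (a + 1)"
    using assms by (auto simp: link_iff)
  then have b: "?P b" and b_max: "\<And>q. ?P q \<Longrightarrow> q \<le> b"
    unfolding b_def using GreatestI_nat[of ?P _ j] Greatest_le_nat[of ?P _ j] by auto
  then show "link a b" "(a, b) \<noteq> (i, j)"
    by simp_all
  have "a < b" "i \<le> a"
    using b assms(3) by (simp_all add: linked_def cell_below_def)
  moreover have "b \<in> cell_below D i j"
    using furthest_link_in_cell_below[OF assms(3)] b b_max by blast
  moreover have "x \<le> a \<or> b \<le> x" if "x \<in> cell_below D i j" for x
    using link_not_over_cell_below[OF assms(1) _ \<open>i \<le> a\<close> _ _ that] b by blast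
  ultimately show "consec (cell_below D i j) a b"
    using assms(3) by (simp add: consec_def)
qed

lemma cell_below_in_cells:
  assumes "link i j" "i + 1 < j"
  shows "cell_below D i j \<in> cells n D"
proof -
  let ?V = "cell_below D i j"
  have ends: "i \<in> ?V" "j \<in> ?V" "Min ?V = i" "Max ?V = j"
    using cell_below_ends[of i j] assms by auto
  have sub: "?V \<subseteq> {i..j}"
    by (auto simp: cell_below_def)
  have linked: "link a b" if ab: "consec ?V a b" for a b
  proof -
    have "a \<in> ?V" "a < j"
      using ab sub unfolding consec_def by fastforce+
    then show ?thesis
      using cell_below_next[OF assms] consec_right_unique ab by metis
  qed
  have sides: "consec ?V a b \<or> a = i \<and> b = j" if ab: "a \<in> ?V" "b \<in> ?V" "link a b" for a b
  proof -
    have "i \<le> a" "b \<le> j" "a < b"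
      using ab sub by (auto simp: linked_def)
    then show ?thesis
      using link_not_over_cell_below[OF assms(1) ab(3)] ab(1,2) unfolding consec_def by blast
  qed
  have "i < j"
    using assms(2) by simp
  then obtain b where b: "consec ?V i b" "(i, b) \<noteq> (i, j)"
    by (rule cell_below_next[OF assms ends(1)])
  then have "b \<in> ?V" "i < b" "b < j"
    using sub by (auto simp: consec_def order_less_le)
  then have "card {i, b, j} = 3" "{i, b, j} \<subseteq> ?V"
    using ends by auto
  then have "card ?V \<ge> 3"
    using card_mono[of ?V "{i, b, j}"] finite_subset[OF sub] by simp
  moreover have "?V \<subseteq> {0..n + 1}"
    using sub assms(1) by (auto simp: link_iff)
  ultimately show ?thesis
    using linked sides assms(1) by (simp add: cells_iff ends)
qed

lemma cell_eq_cell_below: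
  assumes "V \<in> cells n D"
  shows "V = cell_below D (Min V) (Max V)"
proof (intro set_eqI iffI)
  fix x assume x: "x \<in> V"
  have "\<not> covered D (Min V) (Max V) x"
  proof
    assume "covered D (Min V) (Max V) x"
    then obtain a b where ab: "Min V \<le> a" "a < x" "x < b" "b \<le> Max V" "(a, b) \<noteq> (Min V, Max V)"
        "{a, b} \<in> D"
      by (rule coveredE)
    then have "link a b"
      using chordD(4) by simp
    then show False
      using link_over_cell[OF assms _ x] ab by fastforce
  qed
  then show "x \<in> cell_below D (Min V) (Max V)"
    using cell_bounds[OF assms x] by (simp add: cell_below_def)
next
  fix x assume x: "x \<in> cell_below D (Min V) (Max V)"
  show "x \<in> V"
  proof (rule ccontr)
    assume "x \<notin> V"
    moreover from this have "Min V < x" "x < Max V"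
      using x cellD(4,5)[OF assms] by (auto simp: cell_below_def order_less_le)
    ultimately obtain a b where ab: "consec V a b" "a < x" "x < b" "Min V \<le> a" "b \<le> Max V"
      using consec_around[OF cellD(1,4,5)[OF assms]] by metis
    then have "{a, b} \<in> D" "(a, b) \<noteq> (Min V, Max V)"
      using cell_consec_chord[OF assms ab(1)] cell_consec_not_ends[OF assms ab(1)] by auto
    then have "covered D (Min V) (Max V) x"
      unfolding covered_def using ab by blast
    then show False
      using x by (simp add: cell_below_def)
  qed
qed

lemma least_link_over:
  assumes "link i j" "(i, j) \<noteq> (0, n + 1)"
  obtains p q where "link p q" "p \<le> i" "j \<le> q" "(p, q) \<noteq> (i, j)"
    "\<And>a b. link a b \<Longrightarrow> p \<le> a \<Longrightarrow> a \<le> i \<Longrightarrow> j \<le> b \<Longrightarrow> b \<le> q \<Longrightarrow> (a, b) \<noteq> (i, j) \<Longrightarrow> (a, b) = (p, q)"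
proof -
  let ?over = "\<lambda>(p, q). link p q \<and> p \<le> i \<and> j \<le> q \<and> (p, q) \<noteq> (i, j)"
  have "?over (0, n + 1)"
    using assms by (auto simp: link_iff)
  then obtain r where r: "?over r" and r_least: "\<And>r'. ?over r' \<Longrightarrow> snd r - fst r \<le> snd r' - fst r'"
    using ex_has_least_nat[of ?over "(0, n + 1)" "\<lambda>r. snd r - fst r"] by blast
  obtain p q where "r = (p, q)"
    by fastforce
  then have pq: "?over (p, q)" and least: "\<And>a b. ?over (a, b) \<Longrightarrow> q - p \<le> b - a"
    using r r_least[of "(_, _)"] by simp_all
  have "(a, b) = (p, q)"
    if "link a b" "p \<le> a" "a \<le> i" "j \<le> b" "b \<le> q" "(a, b) \<noteq> (i, j)" for a b
    using that least[of a b] by (auto simp: linked_def)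
  with pq show ?thesis
    by (intro that) auto
qed

lemma cell_above_exists:
  assumes "link i j" "(i, j) \<noteq> (0, n + 1)"
  obtains V where "V \<in> cells n D" "consec V i j"
proof -
  obtain p q where pq: "link p q" "p \<le> i" "j \<le> q" "(p, q) \<noteq> (i, j)"
    and least: "\<And>a b. link a b \<Longrightarrow> p \<le> a \<Longrightarrow> a \<le> i \<Longrightarrow> j \<le> b \<Longrightarrow> b \<le> q \<Longrightarrow> (a, b) \<noteq> (i, j) \<Longrightarrow>
      (a, b) = (p, q)"
    using least_link_over[OF assms] by blast
  have ij: "i < j"
    using assms(1) by (simp add: linked_def)
  have "\<not> covered D p q i"
  proof
    assume "covered D p q i"
    then obtain a b where ab: "p \<le> a" "a < i" "i < b" "b \<le> q" "(a, b) \<noteq> (p, q)" "{a, b} \<in> D"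
      by (rule coveredE)
    then have "link a b"
      using chordD(4) by simp
    then show False
      using least[of a b] link_not_crossing[of a b i j] assms(1) ab by auto
  qed
  moreover have "\<not> covered D p q j"
  proof
    assume "covered D p q j"
    then obtain a b where ab: "p \<le> a" "a < j" "j < b" "b \<le> q" "(a, b) \<noteq> (p, q)" "{a, b} \<in> D"
      by (rule coveredE)
    then have "link a b"
      using chordD(4) by simp
    then show False
      using least[of a b] link_not_crossing[of i j a b] assms(1) ab by fastforce
  qed
  ultimately have "i \<in> cell_below D p q" "j \<in> cell_below D p q"
    using pq ij by (auto simp: cell_below_def)
  then have "consec (cell_below D p q) i j"
    using link_not_over_cell_below[OF pq(1) assms(1) pq(2,3) pq(4)[symmetric]] ij
    unfolding consec_def by blast
  moreover have "p + 1 < q"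
    using pq ij by auto
  ultimately show ?thesis
    using that cell_below_in_cells[OF pq(1)] by blast
qed

lemma cell_above_ends_le:
  assumes "V \<in> cells n D" "W \<in> cells n D" "consec V i j" "consec W i j"
  shows "Min W \<le> Min V \<and> Max V \<le> Max W"
proof -
  have ij: "i \<in> V" "j \<in> V" "i \<in> W" "j \<in> W" "i < j"
    using assms(3,4) by (auto simp: consec_def)
  then have "Min W \<le> i" "j \<le> Max W"
    using cell_bounds[OF assms(2)] by blast+
  then have "Min W < i \<and> i < Max W \<or> Min W < j \<and> j < Max W"
    using cell_consec_not_ends[OF assms(2,4)] ij(5) by auto
  then show ?thesis
    using link_over_cell[OF assms(1) cell_base_link[OF assms(2)]] ij by blast
qed

lemma ex1_cell_above:
  assumes "link i j" "(i, j) \<noteq> (0, n + 1)"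
  shows "\<exists>!V. V \<in> cells n D \<and> consec V i j"
proof (rule ex_ex1I)
  show "\<exists>V. V \<in> cells n D \<and> consec V i j"
    using cell_above_exists[OF assms] by blast
next
  fix V W assume VW: "V \<in> cells n D \<and> consec V i j" "W \<in> cells n D \<and> consec W i j"
  then have "Min V = Min W" "Max V = Max W"
    using cell_above_ends_le[of V W] cell_above_ends_le[of W V] by (auto intro: antisym)
  then show "V = W"
    using cell_eq_cell_below VW by metis
qed

end

section \<open>Quiddity and degrees\<close>

definition degree :: "'a set set \<Rightarrow> 'a \<Rightarrow> nat" where
  "degree D i = card {d \<in> D. i \<in> d}"

definition neighbours :: "'a set set \<Rightarrow> 'a \<Rightarrow> 'a set" where
  "neighbours D i = {x. {i, x} \<in> D}"

definition next_vertex :: "nat set \<Rightarrow> nat \<Rightarrow> nat \<Rightarrow> bool" where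
  "next_vertex V a b \<longleftrightarrow> consec V a b \<or> a = Max V \<and> b = Min V"

lemma card_eq_if_uniquely_related:
  assumes "\<And>x. x \<in> A \<Longrightarrow> \<exists>!y. y \<in> B \<and> R x y" "\<And>y. y \<in> B \<Longrightarrow> \<exists>!x. x \<in> A \<and> R x y"
  shows "card A = card B"
proof -
  obtain f where f: "\<And>x. x \<in> A \<Longrightarrow> f x \<in> B \<and> R x (f x)"
    using assms(1) by metis
  obtain g where g: "\<And>y. y \<in> B \<Longrightarrow> g y \<in> A \<and> R (g y) y"
    using assms(2) by metis
  have "bij_betw f A B"
    by (rule bij_betw_byWitness[of A g f B]) (use f g assms in blast)+
  then show ?thesis
    by (rule bij_betw_same_card)
qed

lemma inj_doubleton: "inj (\<lambda>x. {i, x})"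
  by (auto simp: inj_def doubleton_eq_iff)

context dissection
begin

lemma degree_eq_card_neighbours: "degree D i = card (neighbours D i)"
proof -
  have "{d \<in> D. i \<in> d} = (\<lambda>x. {i, x}) ` neighbours D i"
  proof (intro set_eqI iffI)
    fix d assume d: "d \<in> {d \<in> D. i \<in> d}"
    then obtain a b where "d = {a, b}"
      using chord_doubletonE by blast
    with d show "d \<in> (\<lambda>x. {i, x}) ` neighbours D i"
      by (auto simp: neighbours_def insert_commute)
  qed (auto simp: neighbours_def)
  then show ?thesis
    by (simp add: degree_def card_image inj_on_subset[OF inj_doubleton])
qed

lemma finite_neighbours: "finite (neighbours D i)"
  using finite_vimageI[OF finite_chords inj_doubleton] by (simp add: neighbours_def vimage_def)

text \<open>The oriented link from \<open>i\<close> to \<open>x\<close> has a cell on its left.\<close>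

definition left_cell_link :: "nat \<Rightarrow> nat \<Rightarrow> bool" where
  "left_cell_link i x \<longleftrightarrow> link i x \<and> (i, x) \<noteq> (0, n + 1) \<or> link x i \<and> x + 1 < i"

lemma left_cell_link_iff:
  assumes "i \<le> n + 1"
  shows "left_cell_link i x \<longleftrightarrow> x = (if i = n + 1 then 0 else i + 1) \<or> {i, x} \<in> D"
proof (cases x i rule: linorder_cases)
  case less
  then show ?thesis
    using chordD(1-3)[of x i] assms n_pos by (auto simp: left_cell_link_def link_iff insert_commute)
next
  case equal
  then show ?thesis
    using not_chord_loop n_pos by (auto simp: left_cell_link_def link_iff)
next
  case greater
  then show ?thesis
    using chordD(1-3)[of i x] assms n_pos by (auto simp: left_cell_link_def link_iff)
qed

lemma card_left_cell_links:
  assumes "i \<le> n + 1"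
  shows "card {x. left_cell_link i x} = degree D i + 1"
proof -
  let ?next = "if i = n + 1 then 0 else i + 1"
  have "{x. left_cell_link i x} = insert ?next (neighbours D i)"
    using left_cell_link_iff[OF assms] by (auto simp: neighbours_def)
  moreover have "?next \<notin> neighbours D i"
    using chordD(1)[of i "i + 1"] chordD(3)[of 0 "n + 1"]
    by (auto simp: neighbours_def insert_commute)
  ultimately show ?thesis
    using finite_neighbours by (simp add: degree_eq_card_neighbours)
qed

lemma ex1_next_vertex:
  assumes "V \<in> cells n D" "i \<in> V"
  shows "\<exists>!x. left_cell_link i x \<and> next_vertex V i x"
proof (cases "i = Max V")
  case True
  then have "\<not> consec V i x" for x
    using cell_bounds(2)[OF assms(1), of x] by (auto simp: consec_def)
  then show ?thesis
    using True cell_base_link[OF assms(1)] cell_long_base[OF assms(1)]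
    unfolding next_vertex_def left_cell_link_def by blast
next
  case False
  then have "i < Max V"
    using cell_bounds(2)[OF assms] by simp
  then obtain x where "consec V i x"
    by (rule consec_next_exists[OF cellD(1)[OF assms(1)] assms(2)])
  then show ?thesis
    using False cell_consec_link cell_consec_not_base assms(1) consec_right_unique
    unfolding next_vertex_def left_cell_link_def by blast
qed

lemma ex1_cell_next_vertex:
  assumes "left_cell_link i x"
  shows "\<exists>!V. V \<in> cells n D \<and> i \<in> V \<and> next_vertex V i x"
proof -
  consider (above) "link i x" "(i, x) \<noteq> (0, n + 1)" | (below) "link x i" "x + 1 < i"
    using assms unfolding left_cell_link_def by blast
  then show ?thesis
  proof cases
    case above
    have "V \<in> cells n D \<and> i \<in> V \<and> next_vertex V i x \<longleftrightarrow> V \<in> cells n D \<and> consec V i x" for V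
      using cell_long_base[of V] above(1) by (auto simp: next_vertex_def consec_def linked_def)
    then show ?thesis
      using ex1_cell_above[OF above] by simp
  next
    case below
    have "V \<in> cells n D \<and> i \<in> V \<and> next_vertex V i x \<longleftrightarrow> V = cell_below D x i" for V
      using cell_eq_cell_below[of V] cell_below_in_cells[OF below] cell_below_ends[of x i] below(2)
        cellD(5)[of V]
      by (auto simp: next_vertex_def consec_def)
    then show ?thesis
      by simp
  qed
qed

lemma card_cells_at_vertex:
  assumes "i \<le> n + 1"
  shows "card {V \<in> cells n D. i \<in> V} = degree D i + 1"
proof -
  have "card {V \<in> cells n D. i \<in> V} = card {x. left_cell_link i x}"
    by (rule card_eq_if_uniquely_related[where R = "\<lambda>V. next_vertex V i"])
      (use ex1_next_vertex ex1_cell_next_vertex in auto)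
  then show ?thesis
    using card_left_cell_links[OF assms] by simp
qed

lemma quiddity_eq_degrees: "quiddity n D = map (\<lambda>i. degree D i + 1) [0..<n + 2]"
  unfolding quiddity_def by (rule map_cong) (auto simp: card_cells_at_vertex)

section \<open>The index of sides\<close>

lemma parent_exists:
  assumes "V \<in> cells n D" "(Min V, Max V) \<noteq> (0, n + 1)"
  obtains W s where "W \<in> cells n D" "s + 1 < card W" "base_side V = side W s"
    "Max V - Min V < Max W - Min W"
proof -
  obtain W where W: "W \<in> cells n D" "consec W (Min V) (Max V)"
    using ex1_cell_above[OF cell_base_link[OF assms(1)] assms(2)] by blast
  then obtain s where s: "s + 1 < card W" "Min V = vtx W s" "Max V = vtx W (s + 1)"
    using cellD(1) consec_iff_vtx by blast
  then have "base_side V = side W s"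
    using base_side_eq cellD(1,3)[OF assms(1)] by (simp add: side_def)
  moreover have "Min W \<le> Min V" "Max V \<le> Max W" "Min V < Max V"
    using W(2) cell_bounds[OF W(1)] by (auto simp: consec_def)
  then have "Max V - Min V < Max W - Min W"
    using cell_consec_not_ends[OF W] by auto
  ultimately show ?thesis
    using that W(1) s(1) by blast
qed

lemma base_side_index_exists:
  assumes "V \<in> cells n D"
  shows "\<exists>c. z3_index n D (base_side V) c"
  using assms
proof (induction "n + 1 - (Max V - Min V)" arbitrary: V rule: less_induct)
  case less
  show ?case
  proof (cases "(Min V, Max V) = (0, n + 1)")
    case True
    then have "base_side V = base_edge n"
      using base_side_eq cellD(1,3)[OF less.prems] by (simp add: base_edge_def insert_commute)
    then show ?thesis
      using z3_index.base[of n D] by auto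
  next
    case False
    then obtain W s where W: "W \<in> cells n D" "s + 1 < card W" "base_side V = side W s"
        "Max V - Min V < Max W - Min W"
      using parent_exists less.prems by blast
    moreover have "Max W - Min W \<le> n + 1"
      using cell_base_link[OF W(1)] by (auto simp: link_iff)
    ultimately have "n + 1 - (Max W - Min W) < n + 1 - (Max V - Min V)"
      by linarith
    then obtain c where "z3_index n D (base_side W) c"
      using less.hyps W(1) by blast
    then show ?thesis
      using z3_index.side[OF W(1) _ W(2)] W(3) by auto
  qed
qed

lemma side_consec:
  assumes "V \<in> cells n D" "s + 1 < card V"
  shows "consec V (vtx V s) (vtx V (s + 1))"
  using consec_iff_vtx[OF cellD(1)[OF assms(1)]] assms(2) by blast

lemma side_neq_base_edge:
  assumes "V \<in> cells n D" "s + 1 < card V"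
  shows "side V s \<noteq> base_edge n"
  using cell_consec_not_base[OF assms(1) side_consec[OF assms]] side_consec[OF assms]
  by (auto simp: side_def base_edge_def doubleton_eq_iff consec_def)

lemma side_inject:
  assumes "V \<in> cells n D" "s + 1 < card V" "W \<in> cells n D" "t + 1 < card W" "side V s = side W t"
  shows "V = W \<and> s = t"
proof -
  note consec_V = side_consec[OF assms(1,2)] and consec_W = side_consec[OF assms(3,4)]
  have eq: "vtx V s = vtx W t" "vtx V (s + 1) = vtx W (t + 1)"
    using consec_V consec_W assms(5) by (auto simp: side_def doubleton_eq_iff consec_def)
  moreover have "V = W"
    using ex1_cell_above[OF cell_consec_link[OF assms(1) consec_V]
        cell_consec_not_base[OF assms(1) consec_V]] assms(1,3) consec_V consec_W eq by auto
  ultimately show ?thesis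
    using card_le_vtx[OF cellD(1)[OF assms(1)]] assms(2,4) by (metis add_lessD1 add_right_cancel)
qed

lemma z3_index_unique: "z3_index n D e c \<Longrightarrow> z3_index n D e c' \<Longrightarrow> c = c'"
proof (induction arbitrary: c' rule: z3_index.induct)
  case base
  then show ?case
    by cases (use side_neq_base_edge in metis)+
next
  case (side V c s)
  from side.prems show ?case
  proof cases
    case base
    then show ?thesis
      using side_neq_base_edge side by metis
  next
    case (side W d t)
    have "V = W" "s = t"
      using side_inject[OF side.hyps(1,3) side(3,5)] side(1) by auto
    then show ?thesis
      using side side.IH by metis
  qed
qed

lemma z3_index_less_3: "z3_index n D e c \<Longrightarrow> c < 3"
  by (induction rule: z3_index.induct) auto

lemma same_index_as_base_side_iff:
  assumes "V \<in> cells n D" "s + 1 < card V"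
  shows "(\<exists>c. z3_index n D (side V s) c \<and> z3_index n D (base_side V) c) \<longleftrightarrow> s mod 3 = 2"
proof -
  obtain c where c: "z3_index n D (base_side V) c"
    using base_side_index_exists[OF assms(1)] by blast
  have "(\<exists>c. z3_index n D (side V s) c \<and> z3_index n D (base_side V) c) \<longleftrightarrow> (c + s + 1) mod 3 = c"
    using z3_index.side[OF assms(1) c assms(2)] c z3_index_unique by metis
  also have "\<dots> \<longleftrightarrow> s mod 3 = 2"
    using z3_index_less_3[OF c] by presburger
  finally show ?thesis .
qed

end

section \<open>Three-periodicity by counting sides\<close>

text \<open>As each chord is a side of two cells and each polygon edge a side of one, the cells below
  \<open>{i, j}\<close> have \<open>side_count n D i j - 1\<close> sides in total. Here the base edge counts as a chord, as if
  it had a further cell on its other side.\<close>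

definition side_count :: "nat \<Rightarrow> nat set set \<Rightarrow> nat \<Rightarrow> nat \<Rightarrow> nat" where
  "side_count n D i j = 2 * card {d \<in> insert (base_edge n) D. d \<subseteq> {i..j}} + (j - i)"

context dissection
begin

lemma long_link_iff:
  assumes "a + 1 < b"
  shows "link a b \<longleftrightarrow> {a, b} \<in> insert (base_edge n) D"
  using assms chordD(2)[of a b] by (auto simp: link_iff base_edge_def doubleton_eq_iff)

lemma long_linkE:
  assumes "d \<in> insert (base_edge n) D"
  obtains a b where "d = {a, b}" "a + 1 < b" "link a b"
proof (cases "d \<in> D")
  case True
  then obtain a b where "d = {a, b}" "a < b"
    by (rule chord_doubletonE)
  then show ?thesis
    using that chordD(1,4) True by blast
next
  case False
  then show ?thesis
    using that[of 0 "n + 1"] assms n_pos by (auto simp: base_edge_def link_iff)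
qed

lemma side_count_edge: "side_count n D i (i + 1) = 1"
proof -
  have "\<not> d \<subseteq> {i..i + 1}" if d: "d \<in> insert (base_edge n) D" for d
  proof -
    obtain a b where "d = {a, b}" "a + 1 < b"
      using d by (rule long_linkE)
    then show ?thesis
      by auto
  qed
  then have "{d \<in> insert (base_edge n) D. d \<subseteq> {i..i + 1}} = {}"
    by blast
  then show ?thesis
    by (simp only: side_count_def) simp
qed

lemma long_links_split:
  assumes V: "V \<in> cells n D" "v \<in> V" and order: "Min V \<le> x" "x < v" "v < y" "y \<le> Max V"
  defines "L \<equiv> insert (base_edge n) D"
  shows "{d \<in> L. d \<subseteq> {x..y}} = {d \<in> L. d \<subseteq> {x..v}} \<union> {d \<in> L. d \<subseteq> {v..y}} \<union>
    (if (x, y) = (Min V, Max V) then {{x, y}} else {})"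
    (is "?S x y = ?S x v \<union> ?S v y \<union> ?T")
proof (intro set_eqI iffI)
  have base: "{Min V, Max V} \<in> L"
    using long_link_iff[OF cell_long_base[OF V(1)]] cell_base_link[OF V(1)] by (simp add: L_def)
  fix d assume "d \<in> ?S x v \<union> ?S v y \<union> ?T"
  then consider "d \<in> ?S x v" | "d \<in> ?S v y" | "d = {x, y}" "(x, y) = (Min V, Max V)"
    by (auto split: if_splits)
  then show "d \<in> ?S x y"
    by cases (use base order in auto)
next
  fix d assume d: "d \<in> ?S x y"
  then have "d \<in> insert (base_edge n) D"
    by (simp add: L_def)
  then obtain a b where ab: "d = {a, b}" "a + 1 < b" "link a b"
    by (rule long_linkE)
  show "d \<in> ?S x v \<union> ?S v y \<union> ?T"
  proof (cases "a < v \<and> v < b")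
    case True
    then have "a \<le> Min V \<and> Max V \<le> b"
      using link_over_cell[OF V(1) ab(3) V(2)] by blast
    moreover have "x \<le> a" "b \<le> y"
      using d ab(1) by auto
    ultimately have "(a, b) = (x, y)" "(x, y) = (Min V, Max V)"
      using order by auto
    then show ?thesis
      using ab(1) by simp
  next
    case False
    then have "d \<in> ?S x v \<or> d \<in> ?S v y"
      using d ab(1,2) by auto
    then show ?thesis
      by blast
  qed
qed

lemma side_count_split:
  assumes V: "V \<in> cells n D" "v \<in> V" and order: "Min V \<le> x" "x < v" "v < y" "y \<le> Max V"
  shows "side_count n D x y = side_count n D x v + side_count n D v y +
    2 * of_bool ((x, y) = (Min V, Max V))"
proof -
  let ?L = "insert (base_edge n) D"
  let ?S = "\<lambda>x y. {d \<in> ?L. d \<subseteq> {x..y}}"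
  let ?T = "if (x, y) = (Min V, Max V) then {{x, y}} else {}"
  have "?S x v \<inter> ?S v y = {}"
  proof (rule equals0I)
    fix d assume "d \<in> ?S x v \<inter> ?S v y"
    then have "d \<in> ?L" "d \<subseteq> {x..v}" "d \<subseteq> {v..y}"
      by simp_all
    moreover from this(1) obtain a b where "d = {a, b}" "a + 1 < b"
      by (rule long_linkE)
    ultimately show False
      by simp
  qed
  moreover have "(?S x v \<union> ?S v y) \<inter> ?T = {}"
    using order by auto
  ultimately have "card (?S x y) = card (?S x v) + card (?S v y) + card ?T"
    unfolding long_links_split[OF assms] using finite_chords
    by (subst card_Un_disjoint) (auto simp: card_Un_disjoint)
  also have "card ?T = of_bool ((x, y) = (Min V, Max V))"
    by simp
  finally show ?thesis
    using order unfolding side_count_def by linarith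
qed

lemma side_count_between_vertices:
  assumes V: "V \<in> cells n D" and sides: "\<And>a b. consec V a b \<Longrightarrow> side_count n D a b mod 3 = 1"
    and "x \<in> V" "y \<in> V" "x < y"
  shows "side_count n D x y mod 3 =
    (card {z \<in> V. x \<le> z \<and> z < y} + 2 * of_bool ((x, y) = (Min V, Max V))) mod 3"
  using assms(3-5)
proof (induction "y - x" arbitrary: x y rule: less_induct)
  case less
  let ?between = "\<lambda>x y. {z \<in> V. x \<le> z \<and> z < y}"
  show ?case
  proof (cases "consec V x y")
    case True
    then have "?between x y = {x}"
      by (auto simp: consec_def)
    then show ?thesis
      using sides[OF True] cell_consec_not_ends[OF V True] by simp
  next
    case False
    then obtain v where v: "v \<in> V" "x < v" "v < y"
      using less.prems by (auto simp: consec_def not_le)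
    have xy: "Min V \<le> x" "y \<le> Max V"
      using cell_bounds[OF V] less.prems by auto
    have left: "side_count n D x v mod 3 = card (?between x v) mod 3"
      using less.hyps[of v x] less.prems v xy by simp
    have right: "side_count n D v y mod 3 = card (?between v y) mod 3"
      using less.hyps[of y v] less.prems v xy by simp
    have "side_count n D x y mod 3 = (card (?between x v) + card (?between v y) +
        2 * of_bool ((x, y) = (Min V, Max V))) mod 3"
      unfolding side_count_split[OF V v(1) xy(1) v(2,3) xy(2)]
      by (intro mod_add_cong left right refl)
    also have "card (?between x v) + card (?between v y) = card (?between x v \<union> ?between v y)"
      using cellD(1)[OF V] by (intro card_Un_disjoint[symmetric]) auto
    also have "?between x v \<union> ?between v y = ?between x y"
      using v by auto
    finally show ?thesis .
  qed
qed

lemma side_count_cell: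
  assumes "V \<in> cells n D" "\<And>a b. consec V a b \<Longrightarrow> side_count n D a b mod 3 = 1"
  shows "side_count n D (Min V) (Max V) mod 3 = (card V + 1) mod 3"
proof -
  have "{z \<in> V. Min V \<le> z \<and> z < Max V} = V - {Max V}"
    using cell_bounds[OF assms(1)] by (auto simp: order_less_le)
  then have "card {z \<in> V. Min V \<le> z \<and> z < Max V} + 2 = card V + 1"
    using cellD[OF assms(1)] by simp
  then show ?thesis
    using side_count_between_vertices[OF assms cellD(4,5)[OF assms(1)]] cell_long_base[OF assms(1)]
    by simp
qed

lemma three_periodic_iff:
  "D \<in> three_periodic_dissections n \<longleftrightarrow> (\<forall>V\<in>cells n D. 3 dvd card V)"
  using dissection by (simp add: three_periodic_dissections_def)

lemma side_count_link:
  assumes "D \<in> three_periodic_dissections n" "link i j"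
  shows "side_count n D i j mod 3 = 1"
  using assms(2)
proof (induction "j - i" arbitrary: i j rule: less_induct)
  case less
  show ?case
  proof (cases "j = i + 1")
    case True
    then show ?thesis
      using side_count_edge[of i] by simp
  next
    case False
    then have "i + 1 < j"
      using less.prems by (simp add: linked_def)
    define V where "V = cell_below D i j"
    have V: "V \<in> cells n D" "Min V = i" "Max V = j"
      using cell_below_in_cells[OF less.prems \<open>i + 1 < j\<close>] cell_below_ends \<open>i + 1 < j\<close>
      by (auto simp: V_def)
    have "side_count n D a b mod 3 = 1" if ab: "consec V a b" for a b
    proof -
      have "i \<le> a" "b \<le> j" "(a, b) \<noteq> (i, j)"
        using ab cell_bounds[OF V(1)] cell_consec_not_ends[OF V(1) ab] V(2,3)
        by (auto simp: consec_def)
      then show ?thesis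
        using less.hyps[of b a] cell_consec_link[OF V(1) ab] by (auto simp: linked_def)
    qed
    then have "side_count n D i j mod 3 = (card V + 1) mod 3"
      using side_count_cell[OF V(1)] V(2,3) by blast
    moreover have "3 dvd card V"
      using assms(1) V(1) three_periodic_iff by blast
    ultimately show ?thesis
      by presburger
  qed
qed

lemma three_periodic_iff_side_count:
  "D \<in> three_periodic_dissections n \<longleftrightarrow> (\<forall>i j. link i j \<longrightarrow> side_count n D i j mod 3 = 1)"
proof
  assume links: "\<forall>i j. link i j \<longrightarrow> side_count n D i j mod 3 = 1"
  have "3 dvd card V" if V: "V \<in> cells n D" for V
  proof -
    have "side_count n D (Min V) (Max V) mod 3 = (card V + 1) mod 3"
      using side_count_cell[OF V] links cell_consec_link[OF V] by blast
    moreover have "side_count n D (Min V) (Max V) mod 3 = 1"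
      using links cell_base_link[OF V] by blast
    ultimately show ?thesis
      by presburger
  qed
  then show "D \<in> three_periodic_dissections n"
    by (simp add: three_periodic_iff)
qed (use side_count_link in blast)

end

section \<open>Opening surgeries\<close>

definition opened :: "nat set set \<Rightarrow> nat set \<Rightarrow> nat \<Rightarrow> nat \<Rightarrow> nat set set" where
  "opened D V a b = (D - {{a, b}, {Min V, Max V}}) \<union> {{Min V, a}, {b, Max V}}"

lemma (in dissection) opening_surgery_iff:
  assumes V: "V \<in> cells n D" and "3 dvd card V"
  shows "opening_surgery n D V D' \<longleftrightarrow> (\<exists>a b. consec V a b \<and> 3 dvd card {x \<in> V. x \<le> a} \<and>
    {a, b} \<in> D \<and> {Min V, Max V} \<in> D \<and> D' = opened D V a b)"
proof -
  note fin = cellD(1)[OF V] and ne = cellD(3)[OF V]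
  note base = base_side_eq[OF fin ne]
  have "card V - 1 + 1 = card V"
    using cellD(2)[OF V] by simp
  then have ends: "vtx V (card V - 1) = Max V" "vtx V (card V - 1 + 1) = Min V"
    using vtx_first[OF fin ne] vtx_last[OF fin ne] by (simp_all only: vtx_card)
  have "distant V s (card V - 1) \<and>
      (\<exists>c. z3_index n D (side V s) c \<and> z3_index n D (base_side V) c) \<longleftrightarrow>
      s + 1 < card V \<and> 3 dvd card {x \<in> V. x \<le> vtx V s}" for s
  proof (cases "s + 1 < card V")
    case True
    have "distant V s (card V - 1) \<and> s mod 3 = 2 \<longleftrightarrow> 3 dvd s + 1"
      unfolding distant_def using True assms(2) by presburger
    then show ?thesis
      using same_index_as_base_side_iff[OF V True] True card_le_vtx[OF fin, of s] by simp
  qed (simp add: distant_def)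
  moreover have "opened D V (vtx V s) (vtx V (s + 1)) = (D - {side V s, base_side V}) \<union>
      {{vtx V (s + 1), vtx V (card V - 1)}, {vtx V (card V - 1 + 1), vtx V s}}" for s
    by (simp only: opened_def base ends side_def) (simp only: insert_commute)
  then have "opening_surgery n D V D' \<longleftrightarrow> (\<exists>s. (distant V s (card V - 1) \<and>
      (\<exists>c. z3_index n D (side V s) c \<and> z3_index n D (base_side V) c)) \<and>
      side V s \<in> D \<and> base_side V \<in> D \<and> D' = opened D V (vtx V s) (vtx V (s + 1)))"
    unfolding opening_surgery_def base_side_def by auto
  ultimately have "opening_surgery n D V D' \<longleftrightarrow>
      (\<exists>s. (s + 1 < card V \<and> 3 dvd card {x \<in> V. x \<le> vtx V s}) \<and>
      side V s \<in> D \<and> base_side V \<in> D \<and> D' = opened D V (vtx V s) (vtx V (s + 1)))"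
    by (simp only:)
  then show ?thesis
    unfolding base consec_iff_vtx[OF fin] side_def by blast
qed

definition total_length :: "nat set set \<Rightarrow> nat" where
  "total_length D = (\<Sum>d\<in>D. Max d - Min d)"

locale cell_opening = dissection +
  fixes V :: "nat set" and a b :: nat
  assumes cell: "V \<in> cells n D" and consec: "consec V a b"
    and chords: "{a, b} \<in> D" "{Min V, Max V} \<in> D"
    and vertex_left: "\<exists>x\<in>V. Min V < x \<and> x < a" and vertex_right: "\<exists>y\<in>V. b < y \<and> y < Max V"
begin

abbreviation D' :: "nat set set" where "D' \<equiv> opened D V a b"

lemma ends_ordered: "Min V + 1 < a" "a < b" "b + 1 < Max V"
  using vertex_left vertex_right consec by (auto simp: consec_def)

lemma ends_in_cell: "Min V \<in> V" "a \<in> V" "b \<in> V" "Max V \<in> V"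
  using consec cellD(4,5)[OF cell] by (auto simp: consec_def)

lemma Max_cell_le: "Max V \<le> n + 1"
  using cell_base_link[OF cell] by (simp add: link_iff)

lemma new_not_chords: "{Min V, a} \<notin> D" "{b, Max V} \<notin> D"
proof -
  have "\<not> consec V (Min V) a" "\<not> consec V b (Max V)"
    using vertex_left vertex_right unfolding consec_def by (metis leD)+
  then have "\<not> link (Min V) a" "\<not> link b (Max V)"
    using cell_link_side[OF cell] ends_in_cell ends_ordered by fastforce+
  then show "{Min V, a} \<notin> D" "{b, Max V} \<notin> D"
    using ends_ordered by (auto simp: linked_def)
qed

lemma sum_opened:
  fixes f :: "nat set \<Rightarrow> 'b::comm_monoid_add"
  shows "sum f D' + (f {a, b} + f {Min V, Max V}) = sum f D + (f {Min V, a} + f {b, Max V})"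
proof -
  define F where "F = D - {{a, b}, {Min V, Max V}}"
  have F: "finite F" "{a, b} \<notin> F" "{Min V, Max V} \<notin> F" "{Min V, a} \<notin> F" "{b, Max V} \<notin> F"
    using finite_chords new_not_chords by (auto simp: F_def)
  have distinct: "{a, b} \<noteq> {Min V, Max V}" "{Min V, a} \<noteq> {b, Max V}"
    using ends_ordered by (auto simp: doubleton_eq_iff)
  have "D = insert {a, b} (insert {Min V, Max V} F)"
    using chords by (auto simp: F_def)
  then have "sum f D = f {a, b} + (f {Min V, Max V} + sum f F)"
    using F distinct by simp
  moreover have "D' = insert {Min V, a} (insert {b, Max V} F)"
    by (auto simp: opened_def F_def)
  then have "sum f D' = f {Min V, a} + (f {b, Max V} + sum f F)"
    using F distinct by simp
  ultimately show ?thesis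
    by (simp only: ac_simps)
qed

lemma finite_opened: "finite D'"
  using finite_chords by (simp add: opened_def)

lemma card_opened:
  "card {d \<in> D'. P d} + (of_bool (P {a, b}) + of_bool (P {Min V, Max V})) =
    card {d \<in> D. P d} + (of_bool (P {Min V, a}) + of_bool (P {b, Max V}))"
proof -
  have card_eq_sum: "card {d \<in> A. P d} = (\<Sum>d\<in>A. of_bool (P d))" if "finite A" for A
    using that by (simp add: Int_def)
  show ?thesis
    unfolding card_eq_sum[OF finite_chords] card_eq_sum[OF finite_opened] by (rule sum_opened)
qed

lemma degree_opened: "degree D' i = degree D i"
proof -
  have "of_bool (i \<in> {a, b}) + of_bool (i \<in> {Min V, Max V}) =
      (of_bool (i \<in> {Min V, a}) + of_bool (i \<in> {b, Max V}) :: nat)"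
    using ends_ordered by auto
  then show ?thesis
    unfolding degree_def using card_opened[of "\<lambda>d. i \<in> d"] by linarith
qed

lemma total_length_opened: "total_length D' < total_length D"
  using sum_opened[of "\<lambda>d. Max d - Min d"] ends_ordered by (simp add: total_length_def)

lemma not_crossing_cell_chord:
  assumes "d \<in> D" "u \<in> V" "v \<in> V" "u < v"
  shows "\<not> crossing d {u, v}"
proof -
  obtain i j where ij: "d = {i, j}" "i < j"
    using assms(1) by (rule chord_doubletonE)
  then have "link i j"
    using chordD(4) assms(1) by simp
  note over = link_over_cell[OF cell this]
  have "\<not> (i < u \<and> u < j \<and> j < v)"
    using over[OF assms(2)] cell_bounds(2)[OF cell assms(3)] by auto
  moreover have "\<not> (u < i \<and> i < v \<and> v < j)"
    using over[OF assms(3)] cell_bounds(1)[OF cell assms(2)] by auto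
  ultimately show ?thesis
    using ij assms(4) by (simp add: crossing_doubleton_iff)
qed

lemma opened_in_dissections: "D' \<in> dissections n"
proof -
  let ?new = "{{Min V, a}, {b, Max V}}"
  have diagonal: "{u, v} \<in> diagonals n" if "u + 1 < v" "v \<le> n + 1" "(u, v) \<noteq> (0, n + 1)" for u v
    unfolding diagonals_def using that
    by (intro DiffI CollectI exI[of _ u] exI[of _ v]) (auto simp: polygon_edges_eq doubleton_eq_iff)
  have D: "D \<subseteq> diagonals n" "\<And>d e. d \<in> D \<Longrightarrow> e \<in> D \<Longrightarrow> \<not> crossing d e"
    using dissection by (auto simp: dissections_def)
  have sub: "D' \<subseteq> D \<union> ?new"
    by (auto simp: opened_def)
  have "?new \<subseteq> diagonals n"
    using ends_ordered Max_cell_le by (auto intro!: diagonal)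
  then have "D' \<subseteq> diagonals n"
    using D(1) sub by blast
  moreover have old_new: "\<not> crossing d e" if "d \<in> D" "e \<in> ?new" for d e
    using that not_crossing_cell_chord ends_in_cell ends_ordered by auto
  have new_new: "\<not> crossing d e" if "d \<in> ?new" "e \<in> ?new" for d e
    using that ends_ordered by (auto simp: crossing_doubleton_iff)
  have "\<not> crossing d e" if "d \<in> D'" "e \<in> D'" for d e
  proof -
    have "d \<in> D \<union> ?new" "e \<in> D \<union> ?new"
      using that sub by auto
    moreover have "crossing d e \<longleftrightarrow> crossing e d"
      unfolding crossing_def by blast
    ultimately show ?thesis
      using D(2)[of d e] old_new[of d e] old_new[of e d] new_new[of d e] by blast
  qed
  ultimately show ?thesis
    by (simp add: dissections_def)
qed

lemma side_count_opened:
  "side_count n D' i j + 2 * (of_bool ({a, b} \<subseteq> {i..j}) + of_bool ({Min V, Max V} \<subseteq> {i..j})) =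
    side_count n D i j + 2 * (of_bool ({Min V, a} \<subseteq> {i..j}) + of_bool ({b, Max V} \<subseteq> {i..j}))"
proof -
  have "card {d \<in> insert (base_edge n) A. d \<subseteq> {i..j}} =
      of_bool (base_edge n \<subseteq> {i..j}) + card {d \<in> A. d \<subseteq> {i..j}}" if "A \<in> dissections n" for A
  proof -
    interpret A: dissection n A
      using n_pos that by unfold_locales
    have "base_edge n \<notin> A"
      using A.chordD(3)[of 0 "n + 1"] by (auto simp: base_edge_def insert_commute)
    moreover have "{d \<in> insert (base_edge n) A. d \<subseteq> {i..j}} = (if base_edge n \<subseteq> {i..j} then
        insert (base_edge n) {d \<in> A. d \<subseteq> {i..j}} else {d \<in> A. d \<subseteq> {i..j}})"
      by auto
    ultimately show ?thesis
      using A.finite_chords by simp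
  qed
  then show ?thesis
    using card_opened[of "\<lambda>d. d \<subseteq> {i..j}"] dissection opened_in_dissections
    by (simp add: side_count_def)
qed

lemma side_count_opened_old_link:
  assumes "link i j" "(i, j) \<noteq> (a, b)" "(i, j) \<noteq> (Min V, Max V)"
  shows "side_count n D' i j = side_count n D i j"
proof (cases "\<exists>v\<in>V. i < v \<and> v < j")
  case True
  then have "i \<le> Min V" "Max V \<le> j"
    using link_over_cell[OF cell assms(1)] by auto
  then show ?thesis
    using side_count_opened[of i j] ends_ordered by simp
next
  case False
  then have none: "\<not> (i < v \<and> v < j)" if "v \<in> V" for v
    using that by blast
  have "\<not> {Min V, a} \<subseteq> {i..j}" "\<not> {b, Max V} \<subseteq> {i..j}" "\<not> {Min V, Max V} \<subseteq> {i..j}"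
    using vertex_left vertex_right none ends_ordered by fastforce+
  moreover have "\<not> {a, b} \<subseteq> {i..j}"
    using none[of a] none[of b] ends_in_cell ends_ordered assms(2) by auto
  ultimately show ?thesis
    using side_count_opened[of i j] by (simp del: insert_subset)
qed

lemma side_count_opened_new_chords:
  assumes "D \<in> three_periodic_dissections n" "3 dvd card {x \<in> V. x \<le> a}"
  shows "side_count n D' (Min V) a mod 3 = 1" "side_count n D' b (Max V) mod 3 = 1"
proof -
  let ?left = "{x \<in> V. Min V \<le> x \<and> x < a}" and ?right = "{x \<in> V. b \<le> x \<and> x < Max V}"
  have sides: "side_count n D u v mod 3 = 1" if "consec V u v" for u v
    using side_count_link[OF assms(1)] cell_consec_link[OF cell that] by blast
  have fin: "finite V"
    using cellD(1)[OF cell] .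
  have "{x \<in> V. x \<le> a} = insert a ?left" "{x \<in> V. b \<le> x} = insert (Max V) ?right"
    using cell_bounds[OF cell] ends_in_cell ends_ordered by (auto simp: order_less_le)
  then have card_eqs: "card {x \<in> V. x \<le> a} = card ?left + 1" "card {x \<in> V. b \<le> x} = card ?right + 1"
    using fin by simp_all
  have "side_count n D (Min V) a mod 3 = card ?left mod 3"
    using side_count_between_vertices[OF cell sides, of "Min V" a] ends_in_cell ends_ordered by simp
  moreover have "side_count n D' (Min V) a = side_count n D (Min V) a + 2"
    using side_count_opened[of "Min V" a] ends_ordered by simp
  ultimately show "side_count n D' (Min V) a mod 3 = 1"
    using assms(2) card_eqs(1) by presburger
  have "side_count n D b (Max V) mod 3 = card ?right mod 3"
    using side_count_between_vertices[OF cell sides, of b "Max V"] ends_in_cell ends_ordered by simp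
  moreover have "side_count n D' b (Max V) = side_count n D b (Max V) + 2"
    using side_count_opened[of b "Max V"] ends_ordered by simp
  moreover have "3 dvd card V"
    using assms(1) cell three_periodic_iff by blast
  then have "3 dvd card {x \<in> V. b \<le> x}"
    using assms(2) card_consec_split[OF fin consec] by (simp add: dvd_add_right_iff)
  ultimately show "side_count n D' b (Max V) mod 3 = 1"
    using card_eqs(2) by presburger
qed

lemma three_periodic_opened:
  assumes "D \<in> three_periodic_dissections n" "3 dvd card {x \<in> V. x \<le> a}"
  shows "D' \<in> three_periodic_dissections n"
proof -
  interpret D': dissection n D'
    using n_pos opened_in_dissections by unfold_locales
  have "side_count n D' i j mod 3 = 1" if ij: "D'.link i j" for i j
  proof -
    have "i < j"
      using ij by (simp add: linked_def)
    have "{a, b} \<notin> D'" "{Min V, Max V} \<notin> D'"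
      using ends_ordered by (auto simp: opened_def doubleton_eq_iff)
    then have "(i, j) \<noteq> (a, b)" "(i, j) \<noteq> (Min V, Max V)"
      using ij ends_ordered chordD(1,3)[OF chords(1)] chordD(1,3)[OF chords(2)]
      by (auto simp: D'.link_iff)
    consider (old) "link i j" | "(i, j) = (Min V, a)" | "(i, j) = (b, Max V)"
      using ij ends_ordered \<open>i < j\<close> by (auto simp: linked_def opened_def doubleton_eq_iff)
    then show ?thesis
    proof cases
      case old
      then show ?thesis
        using side_count_opened_old_link side_count_link[OF assms(1)]
          \<open>(i, j) \<noteq> (a, b)\<close> \<open>(i, j) \<noteq> (Min V, Max V)\<close> by simp
    qed (use side_count_opened_new_chords[OF assms] in auto)
  qed
  then show ?thesis
    by (simp add: D'.three_periodic_iff_side_count)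
qed

end

context dissection
begin

lemma cell_opening_if_dvd:
  assumes V: "V \<in> cells n D" and ab: "consec V a b"
    and dvd: "3 dvd card V" "3 dvd card {x \<in> V. x \<le> a}"
    and chords: "{a, b} \<in> D" "{Min V, Max V} \<in> D"
  shows "cell_opening n D V a b"
proof unfold_locales
  have fin: "finite V"
    using cellD(1)[OF V] .
  have pos: "card {x \<in> V. x \<le> a} > 0" "card {x \<in> V. b \<le> x} > 0"
    using fin ab by (auto simp: card_gt_0_iff consec_def)
  have "3 \<le> card {x \<in> V. x \<le> a}"
    using dvd_imp_le[OF dvd(2) pos(1)] .
  then obtain x where "x \<in> V" "x \<le> a" "x \<noteq> Min V" "x \<noteq> a"
    using ex_other_than_two[of "{x \<in> V. x \<le> a}" "Min V" a] by blast
  then show "\<exists>x\<in>V. Min V < x \<and> x < a"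
    using cell_bounds(1)[OF V, of x] by (auto simp: order_less_le)
  have "3 dvd card {x \<in> V. b \<le> x}"
    using dvd card_consec_split[OF fin ab] by (simp add: dvd_add_right_iff)
  then have "3 \<le> card {x \<in> V. b \<le> x}"
    using dvd_imp_le pos(2) by blast
  then obtain y where "y \<in> V" "b \<le> y" "y \<noteq> b" "y \<noteq> Max V"
    using ex_other_than_two[of "{x \<in> V. b \<le> x}" b "Max V"] by blast
  then show "\<exists>y\<in>V. b < y \<and> y < Max V"
    using cell_bounds(2)[OF V, of y] by (auto simp: order_less_le)
qed (use V ab chords in simp_all)

lemma opening_surgery_decreases:
  assumes periodic: "D \<in> three_periodic_dissections n" and V: "V \<in> cells n D"
    and surgery: "opening_surgery n D V D'"
  shows "D' \<in> three_periodic_dissections n" "degree D' i = degree D i"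
    "total_length D' < total_length D"
proof -
  have "3 dvd card V"
    using periodic V three_periodic_iff by blast
  then obtain a b where ab: "consec V a b" "3 dvd card {x \<in> V. x \<le> a}" "{a, b} \<in> D"
      "{Min V, Max V} \<in> D" and D': "D' = opened D V a b"
    using opening_surgery_iff[OF V] surgery by blast
  then interpret cell_opening n D V a b
    using cell_opening_if_dvd[OF V] \<open>3 dvd card V\<close> by blast
  show "D' \<in> three_periodic_dissections n" "degree D' i = degree D i"
    "total_length D' < total_length D"
    unfolding D' by (rule three_periodic_opened[OF periodic ab(2)] degree_opened total_length_opened)+
qed

end

lemma maximally_open_exists:
  assumes "n \<ge> 1" "D \<in> three_periodic_dissections n"
  shows "\<exists>D'\<in>three_periodic_dissections n. maximally_open n D' \<and> (\<forall>i. degree D' i = degree D i)"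
  using assms(2)
proof (induction "total_length D" arbitrary: D rule: less_induct)
  case less
  then interpret dissection n D
    using assms(1) by unfold_locales (simp_all add: three_periodic_dissections_def)
  show ?case
  proof (cases "maximally_open n D")
    case True
    then show ?thesis
      using less.prems by blast
  next
    case False
    then obtain V D' where V: "V \<in> cells n D" "opening_surgery n D V D'"
      unfolding maximally_open_def maximally_open_cell_def by blast
    note decreases = opening_surgery_decreases[OF less.prems V]
    then show ?thesis
      using less.hyps[OF decreases(3,1)] by simp
  qed
qed

section \<open>Uniqueness\<close>

text \<open>At the first vertex \<open>i\<close> where two dissections with equal degrees differ, \<open>D'\<close> closes a chord
  \<open>{y, i}\<close> while \<open>D\<close> keeps a longer chord at \<open>y\<close> open and opens one at \<open>i\<close>. The vertices up to \<open>i\<close>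
  of the cell of \<open>D\<close> below that longer chord form a cell of \<open>D'\<close>, so their number is divisible
  by 3 and the cell of \<open>D\<close> admits an opening surgery.\<close>

locale first_difference = D: dissection n D + D': dissection n D'
  for n :: nat and D D' :: "nat set set" +
  fixes y i :: nat
  assumes same_degrees: "v \<le> n + 1 \<Longrightarrow> degree D v = degree D' v"
    and agree_before: "p < q \<Longrightarrow> q < i \<Longrightarrow> {p, q} \<in> D \<longleftrightarrow> {p, q} \<in> D'"
    and agree_at: "y < p \<Longrightarrow> p < i \<Longrightarrow> {p, i} \<in> D \<longleftrightarrow> {p, i} \<in> D'"
    and closing: "y < i" "{y, i} \<in> D'" "{y, i} \<notin> D"
begin

lemma i_le: "i \<le> n + 1"
  using D'.chordD(2) closing by blast

lemma agree_before_unordered: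
  assumes "p < i" "q < i"
  shows "{p, q} \<in> D \<longleftrightarrow> {p, q} \<in> D'"
  using assms agree_before[of p q] agree_before[of q p] D.not_chord_loop D'.not_chord_loop
  by (cases p q rule: linorder_cases) (auto simp: insert_commute)

lemma neighbours_eqI:
  assumes "v \<le> n + 1" "neighbours D v \<subseteq> neighbours D' v \<or> neighbours D' v \<subseteq> neighbours D v"
  shows "neighbours D v = neighbours D' v"
proof -
  have "card (neighbours D v) = card (neighbours D' v)"
    using same_degrees[OF assms(1)]
    by (simp add: D.degree_eq_card_neighbours D'.degree_eq_card_neighbours)
  then show ?thesis
    using assms(2) card_subset_eq D.finite_neighbours D'.finite_neighbours by metis
qed

lemma longer_chord_exists: "\<exists>w>i. {y, w} \<in> D"
proof (rule ccontr)
  assume no: "\<not> ?thesis"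
  have "neighbours D y \<subseteq> neighbours D' y"
  proof
    fix x assume x: "x \<in> neighbours D y"
    then have "x \<noteq> i" "\<not> i < x"
      using no closing(3) by (auto simp: neighbours_def)
    then show "x \<in> neighbours D' y"
      using x agree_before_unordered[OF closing(1), of x] by (simp add: neighbours_def)
  qed
  then show False
    using neighbours_eqI[of y] closing i_le by (auto simp: neighbours_def)
qed

definition open_end :: nat where
  "open_end = (LEAST w. i < w \<and> {y, w} \<in> D)"

lemma chord_open_end: "i < open_end" "{y, open_end} \<in> D"
  using LeastI_ex[OF longer_chord_exists] by (auto simp: open_end_def)

lemma open_end_le: "i < x \<Longrightarrow> {y, x} \<in> D \<Longrightarrow> open_end \<le> x"
  by (simp add: open_end_def Least_le)

lemma link_open_end: "D.link y open_end"
  using D.chordD(4)[OF chord_open_end(2)] chord_open_end(1) closing(1) by simp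

lemma no_chord_over_i:
  assumes "y < z" "z < i" "i < x"
  shows "{z, x} \<notin> D"
proof
  assume zx: "{z, x} \<in> D"
  have within: "u \<le> i" if "{z, u} \<in> D'" for u
  proof (rule ccontr)
    assume "\<not> u \<le> i"
    then have "D'.link z u"
      using D'.chordD(4) that assms(2) by simp
    then show False
      using D'.link_not_crossing[OF D'.chordD(4)[OF closing(2,1)]] assms \<open>\<not> u \<le> i\<close> by blast
  qed
  have "neighbours D' z \<subseteq> neighbours D z"
  proof
    fix u assume u: "u \<in> neighbours D' z"
    then consider "u < i" | "u = i"
      using within by (fastforce simp: neighbours_def)
    then show "u \<in> neighbours D z"
      using u agree_before_unordered[OF assms(2)] agree_at[OF assms(1,2)]
      by cases (auto simp: neighbours_def)
  qed
  then have "{z, x} \<in> D'"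
    using neighbours_eqI[of z] zx assms(2) i_le by (auto simp: neighbours_def)
  then show False
    using within assms(3) by fastforce
qed

abbreviation open_cell :: "nat set" where "open_cell \<equiv> cell_below D y open_end"

lemma i_not_covered: "\<not> covered D y open_end i"
proof
  assume "covered D y open_end i"
  then obtain a b where ab: "y \<le> a" "a < i" "i < b" "b \<le> open_end" "(a, b) \<noteq> (y, open_end)"
      "{a, b} \<in> D"
    by (rule coveredE)
  then have "a = y"
    using no_chord_over_i[of a b] by fastforce
  then show False
    using open_end_le[of b] ab by simp
qed

lemma agree_within:
  assumes "y \<le> p" "p < q" "q \<le> i" "(p, q) \<noteq> (y, i)"
  shows "{p, q} \<in> D \<longleftrightarrow> {p, q} \<in> D'"
  using assms agree_before[of p q] agree_at[of p] by (cases "q = i") auto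

lemma covered_iff:
  assumes "x \<le> i"
  shows "covered D y open_end x \<longleftrightarrow> covered D' y i x"
proof
  assume "covered D y open_end x"
  then obtain a b where ab: "y \<le> a" "a < x" "x < b" "b \<le> open_end" "(a, b) \<noteq> (y, open_end)"
      "{a, b} \<in> D"
    by (rule coveredE)
  have "b \<le> i"
  proof (rule ccontr)
    assume "\<not> b \<le> i"
    then have "covered D y open_end i"
      unfolding covered_def using ab assms by (intro exI[of _ a] exI[of _ b]) auto
    then show False
      using i_not_covered by contradiction
  qed
  moreover have "(a, b) \<noteq> (y, i)"
    using ab(6) closing(3) by auto
  ultimately have "{a, b} \<in> D'"
    using agree_within[of a b] ab by simp
  then show "covered D' y i x"
    unfolding covered_def using ab \<open>b \<le> i\<close> \<open>(a, b) \<noteq> (y, i)\<close> by blast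
next
  assume "covered D' y i x"
  then obtain a b where ab: "y \<le> a" "a < x" "x < b" "b \<le> i" "(a, b) \<noteq> (y, i)" "{a, b} \<in> D'"
    by (rule coveredE)
  then have "{a, b} \<in> D"
    using agree_within[of a b] by simp
  moreover have "b \<le> open_end" "(a, b) \<noteq> (y, open_end)"
    using ab(4) chord_open_end(1) by auto
  ultimately show "covered D y open_end x"
    unfolding covered_def using ab by blast
qed

lemma open_cell_upto_i: "{x \<in> open_cell. x \<le> i} = cell_below D' y i"
  using covered_iff chord_open_end(1) by (auto simp: cell_below_def)

lemma chord_opens_at_i: "\<exists>u>i. {i, u} \<in> D"
proof (rule ccontr)
  assume no: "\<not> ?thesis"
  have "neighbours D i \<subseteq> neighbours D' i"
  proof
    fix u assume "u \<in> neighbours D i"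
    then have u: "{i, u} \<in> D"
      by (simp add: neighbours_def)
    then have "u < i"
      using no D.not_chord_loop by (metis linorder_neqE_nat)
    then have "D.link u i"
      using D.chordD(4)[of u i] u by (simp add: insert_commute)
    then have "\<not> u < y"
      using D.link_not_crossing[OF _ link_open_end] closing(1) chord_open_end(1) by fastforce
    moreover have "u \<noteq> y"
      using u closing(3) by (auto simp: insert_commute)
    ultimately show "u \<in> neighbours D' i"
      using agree_at[of u] \<open>u < i\<close> u by (simp add: neighbours_def insert_commute)
  qed
  then show False
    using neighbours_eqI[of i] closing(2,3) i_le by (auto simp: neighbours_def insert_commute)
qed

lemma open_cell_in_cells: "open_cell \<in> cells n D"
  using D.cell_below_in_cells[OF link_open_end] chord_open_end(1) closing(1) by simp

lemma open_cell_ends: "Min open_cell = y" "Max open_cell = open_end"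
  using cell_below_ends[of y open_end] chord_open_end(1) closing(1) by auto

lemma dvd_card_open_cell_upto_i:
  assumes "D' \<in> three_periodic_dissections n"
  shows "3 dvd card {x \<in> open_cell. x \<le> i}"
proof -
  have "cell_below D' y i \<in> cells n D'"
    using D'.cell_below_in_cells D'.chordD(1,4)[OF closing(2,1)] by blast
  then show ?thesis
    using assms by (simp add: open_cell_upto_i D'.three_periodic_iff)
qed

lemma consec_i_chord:
  assumes "consec open_cell i b"
  shows "{i, b} \<in> D"
proof (rule D.cell_consec_chord[OF open_cell_in_cells assms])
  obtain u where u: "i < u" "{i, u} \<in> D"
    using chord_opens_at_i by blast
  have "\<not> b < u"
  proof
    assume "b < u"
    then have "i \<le> Min open_cell"
      using D.link_over_cell[OF open_cell_in_cells D.chordD(4)[OF u(2,1)], of b] assms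
      by (auto simp: consec_def)
    then show False
      using open_cell_ends(1) closing(1) by simp
  qed
  then show "b \<noteq> i + 1"
    using D.chordD(1)[OF u(2,1)] by simp
qed

lemma not_maximally_open:
  assumes "D \<in> three_periodic_dissections n" "D' \<in> three_periodic_dissections n"
  shows "\<not> maximally_open n D"
proof -
  have "i \<in> open_cell" "i < Max open_cell"
    using i_not_covered chord_open_end(1) closing(1) open_cell_ends(2)
    by (simp_all add: cell_below_def)
  then obtain b where b: "consec open_cell i b"
    by (rule consec_next_exists[OF D.cellD(1)[OF open_cell_in_cells]])
  moreover have "{Min open_cell, Max open_cell} \<in> D"
    using open_cell_ends chord_open_end(2) by simp
  moreover have "3 dvd card open_cell"
    using assms(1) open_cell_in_cells D.three_periodic_iff by blast
  ultimately have "opening_surgery n D open_cell (opened D open_cell i b)"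
    using D.opening_surgery_iff[OF open_cell_in_cells] consec_i_chord
      dvd_card_open_cell_upto_i[OF assms(2)] by blast
  then show ?thesis
    using open_cell_in_cells by (auto simp: maximally_open_def maximally_open_cell_def)
qed

end

lemma first_difference_exists:
  assumes "dissection n D" "dissection n D'" "D \<noteq> D'"
    and degrees: "\<And>v. v \<le> n + 1 \<Longrightarrow> degree D v = degree D' v"
  obtains y i where "first_difference n D D' y i \<or> first_difference n D' D y i"
proof -
  let ?differ = "\<lambda>y i. y < i \<and> ({y, i} \<in> D) \<noteq> ({y, i} \<in> D')"
  obtain d where "(d \<in> D) \<noteq> (d \<in> D')"
    using assms(3) by blast
  then have "\<exists>i y. ?differ y i"
    using dissection.chord_doubletonE assms(1,2) by metis
  then obtain i where i: "\<exists>y. ?differ y i" and i_least: "\<And>j. j < i \<Longrightarrow> \<not> (\<exists>y. ?differ y j)"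
    using exists_least_iff[of "\<lambda>i. \<exists>y. ?differ y i"] by blast
  define y where "y = (GREATEST y. ?differ y i)"
  have y: "?differ y i"
    unfolding y_def by (rule GreatestI_ex_nat[OF i, of i]) simp
  have y_greatest: "z \<le> y" if "?differ z i" for z
    unfolding y_def by (rule Greatest_le_nat[of "\<lambda>y. ?differ y i", OF that, of i]) simp
  have agree_before: "{p, q} \<in> D \<longleftrightarrow> {p, q} \<in> D'" if "p < q" "q < i" for p q
    using i_least that by blast
  have agree_at: "{p, i} \<in> D \<longleftrightarrow> {p, i} \<in> D'" if "y < p" "p < i" for p
    using y_greatest[of p] that by auto
  have "first_difference n D D' y i \<or> first_difference n D' D y i"
    using y assms agree_before agree_at
    by (auto simp: first_difference_def first_difference_axioms_def)
  then show ?thesis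
    using that by blast
qed

lemma maximally_open_unique:
  assumes "n \<ge> 1" "D \<in> three_periodic_dissections n" "D' \<in> three_periodic_dissections n"
    and degrees: "\<And>v. v \<le> n + 1 \<Longrightarrow> degree D v = degree D' v"
    and maximal: "maximally_open n D" "maximally_open n D'"
  shows "D = D'"
proof (rule ccontr)
  assume "D \<noteq> D'"
  have dissections: "dissection n D" "dissection n D'"
    using assms(1-3) by (auto simp: three_periodic_dissections_def dissection_def)
  obtain y i where "first_difference n D D' y i \<or> first_difference n D' D y i"
    using first_difference_exists[OF dissections \<open>D \<noteq> D'\<close> degrees] .
  then show False
    using first_difference.not_maximally_open assms(2,3) maximal by blast
qed

lemma same_quiddity_iff_same_degrees:
  assumes "n \<ge> 1" "D \<in> three_periodic_dissections n" "D' \<in> three_periodic_dissections n"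
  shows "(D, D') \<in> same_quiddity n \<longleftrightarrow> (\<forall>i\<le>n + 1. degree D' i = degree D i)"
proof -
  have "dissection n D" "dissection n D'"
    using assms by (auto simp: three_periodic_dissections_def dissection_def)
  then show ?thesis
    using assms(2,3)
    by (auto simp: same_quiddity_def dissection.quiddity_eq_degrees less_Suc_eq_le simp del: upt_Suc)
qed

theorem theorem6p20:
  fixes n :: nat
  assumes "n \<ge> 1"
  shows "\<forall>K \<in> three_periodic_dissections n // same_quiddity n.
           \<exists>!D. D \<in> K \<and> maximally_open n D"
proof
  fix K assume "K \<in> three_periodic_dissections n // same_quiddity n"
  then obtain D where D: "D \<in> three_periodic_dissections n" "K = same_quiddity n `` {D}"
    by (rule quotientE)
  have K_iff: "D' \<in> K \<longleftrightarrow>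
      D' \<in> three_periodic_dissections n \<and> (\<forall>i\<le>n + 1. degree D' i = degree D i)" for D'
    using same_quiddity_iff_same_degrees[OF assms D(1), of D'] D by (auto simp: same_quiddity_def)
  obtain M where "M \<in> three_periodic_dissections n" "maximally_open n M" "\<forall>i. degree M i = degree D i"
    using maximally_open_exists[OF assms D(1)] by blast
  then have M: "M \<in> K" "maximally_open n M"
    by (simp_all add: K_iff)
  moreover have "M' = M" if "M' \<in> K \<and> maximally_open n M'" for M'
    using maximally_open_unique[OF assms, of M' M] K_iff M that by simp
  ultimately show "\<exists>!D. D \<in> K \<and> maximally_open n D"
    by blast
qed

end
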